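(* Let $x>0$, let $\sigma,\mu,\xi,\zeta,\vartheta,l,m\in\mathbb{C}$, $\eta,\nu,k\in\mathbb{R}$ and $q\in\mathbb{R}^+$, with $\Re(\sigma)>0$, $\Re(\xi)>0$, $\Re(\zeta)>0$, $\Re(\vartheta)>0$, $\Re(\mu)>0$, $\Re(l)>0$, $\Re(m)>0$, $\eta>0$. Assume that $\frac{\xi}{k}$, $\frac{\nu}{\eta}$ and $\nu$ are positive real numbers and $1+\frac{\xi}{k}-q\ge 0$, and that the left-hand side below is defined and the Fox-Wright series on the right-hand side converges. Then $$B\left\{\left({}^{\eta}D^{\sigma}_{0+}\,t^\mu E^{\vartheta,q}_{k,\xi,\zeta}\big((tz)^\nu\big)\right)(x):l,m\right\}=\Gamma(m)\,x^{\mu-\sigma\eta}\,\frac{\eta^\sigma}{\Gamma\left(\frac{\vartheta}{k}\right)}\,k^{1-\frac{\zeta}{k}}\;{}_{3}\Psi_{3}\left[\begin{array}{c}\left(\frac{\vartheta}{k},q\right),\ \left(\frac{\mu}{\eta}+1,\frac{\nu}{\eta}\right),\ (l,\nu);\\ \left(\frac{\zeta}{k},\frac{\xi}{k}\right),\ \left(\frac{\mu}{\eta}-\sigma+1,\frac{\nu}{\eta}\right),\ (l+m,\nu);\end{array}\ k^{\,q-\frac{\xi}{k}}\,x^{\nu}\right],$$ where the Beta transform is taken with respect to the variable $z$.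
   Context: The $k$-gamma function is $\Gamma_k(\vartheta)=k^{\frac{\vartheta}{k}-1}\Gamma\left(\frac{\vartheta}{k}\right)$, and the $k$-Pochhammer symbol is $(\vartheta)_{nq,k}=k^{nq}\left(\frac{\vartheta}{k}\right)_{nq}$, where $(a)_{nq}=\Gamma(a+nq)/\Gamma(a)$. The generalized $k$-Mittag-Leffler function is $$E^{\vartheta,q}_{k,\xi,\zeta}(z)=\sum_{n=0}^\infty\frac{(\vartheta)_{nq,k}\,z^n}{\Gamma_k(n\xi+\zeta)\,n!},$$ for $k\in\mathbb{R}$, $\Re(\xi)>0$, $\Re(\zeta)>0$, $\Re(\vartheta)>0$, $q\in\mathbb{R}^+$. The Fox-Wright function is $${}_p\Psi_q\left[\begin{array}{c}(a_1,\xi_1),\dots,(a_p,\xi_p);\\ (b_1,\zeta_1),\dots,(b_q,\zeta_q);\end{array}\ z\right]=\sum_{n=0}^\infty\frac{\prod_{i=1}^p\Gamma(a_i+\xi_i n)}{\prod_{j=1}^q\Gamma(b_j+\zeta_j n)}\frac{z^n}{n!},$$ where $\xi_i,\zeta_j\in\mathbb{R}^+$ and $1+\sum_j\zeta_j-\sum_i\xi_i\ge0$ (here $p,q$ as subscripts of $\Psi$ are the numbers of parameter pairs). As usual $1/\Gamma$ is $0$ at the poles of $\Gamma$. For $\sigma\in\mathbb{C}$, $\Re(\sigma)>0$, $\eta>0$, $n=[\Re(\sigma)]+1$ (with $[\cdot]$ the integer part) and $x>0$, the generalized fractional derivative is $$\left({}^{\eta}D^{\sigma}_{0+}f(t)\right)(x)=\frac{\eta^{\sigma-n+1}}{\Gamma(n-\sigma)}\left(x^{1-\eta}\frac{d}{dx}\right)^n\int_0^x\frac{t^{\eta-1}f(t)}{(x^\eta-t^\eta)^{\sigma-n+1}}\,dt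 .$$ It is defined when $f$ is defined on $(0,b)$ for some $b>x$ (in particular any series defining $f$ converges there), the integral converges absolutely for all upper limits near $x$, and the indicated derivatives exist at $x$. Here, for each fixed $z\in(0,1)$, it acts on $f(t)=t^\mu E^{\vartheta,q}_{k,\xi,\zeta}((tz)^\nu)$ as a function of $t$. The Beta transform of a function $g(z)$ is $B\{g(z):l,m\}=\int_0^1 z^{l-1}(1-z)^{m-1}g(z)\,dz$. *)

theory Defs
  imports "HOL-Analysis.Analysis"
begin

text \<open>
  The library sets \<open>Gamma\<close> to \<open>0\<close> at its poles and \<open>x / 0 = 0\<close>, so that dividing by a
  \<open>Gamma\<close> value realises the usual convention that \<open>1 / \<Gamma>\<close> vanishes at the poles of \<open>\<Gamma>\<close>.
  Complex powers are principal ones; all bases occurring in the theorem are positive reals.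
\<close>

definition k_gamma :: "real \<Rightarrow> complex \<Rightarrow> complex" where
  "k_gamma k \<theta> = of_real k powr (\<theta> / of_real k - 1) * Gamma (\<theta> / of_real k)"

text \<open>The library's \<open>pochhammer\<close> only covers natural number indices; here the index is real.\<close>

definition real_pochhammer :: "complex \<Rightarrow> real \<Rightarrow> complex" where
  "real_pochhammer a s = Gamma (a + of_real s) / Gamma a"

definition k_pochhammer :: "real \<Rightarrow> complex \<Rightarrow> real \<Rightarrow> complex" where
  "k_pochhammer k \<theta> s = of_real k powr of_real s * real_pochhammer (\<theta> / of_real k) s"

definition k_mittag_leffler_term ::
  "real \<Rightarrow> complex \<Rightarrow> real \<Rightarrow> complex \<Rightarrow> complex \<Rightarrow> complex \<Rightarrow> nat \<Rightarrow> complex" where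
  "k_mittag_leffler_term k \<theta> q \<xi> \<zeta> z n =
     k_pochhammer k \<theta> (of_nat n * q) * z ^ n / (k_gamma k (of_nat n * \<xi> + \<zeta>) * fact n)"

definition k_mittag_leffler ::
  "real \<Rightarrow> complex \<Rightarrow> real \<Rightarrow> complex \<Rightarrow> complex \<Rightarrow> complex \<Rightarrow> complex" where
  "k_mittag_leffler k \<theta> q \<xi> \<zeta> z = (\<Sum>n. k_mittag_leffler_term k \<theta> q \<xi> \<zeta> z n)"

definition fox_wright_term ::
  "(complex \<times> real) list \<Rightarrow> (complex \<times> real) list \<Rightarrow> complex \<Rightarrow> nat \<Rightarrow> complex" where
  "fox_wright_term as bs z n =
     (\<Prod>(a, \<alpha>)\<leftarrow>as. Gamma (a + of_real \<alpha> * of_nat n)) /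
     (\<Prod>(b, \<beta>)\<leftarrow>bs. Gamma (b + of_real \<beta> * of_nat n)) * (z ^ n / fact n)"

definition fox_wright ::
  "(complex \<times> real) list \<Rightarrow> (complex \<times> real) list \<Rightarrow> complex \<Rightarrow> complex" where
  "fox_wright as bs z = (\<Sum>n. fox_wright_term as bs z n)"

definition frac_order :: "complex \<Rightarrow> nat" where
  "frac_order \<sigma> = nat \<lfloor>Re \<sigma>\<rfloor> + 1"

definition frac_integrand :: "real \<Rightarrow> complex \<Rightarrow> (real \<Rightarrow> complex) \<Rightarrow> real \<Rightarrow> real \<Rightarrow> complex" where
  "frac_integrand \<eta> \<sigma> f x t =
     of_real (t powr (\<eta> - 1)) * f t /
     of_real (x powr \<eta> - t powr \<eta>) powr (\<sigma> - of_nat (frac_order \<sigma>) + 1)"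

definition frac_integral :: "real \<Rightarrow> complex \<Rightarrow> (real \<Rightarrow> complex) \<Rightarrow> real \<Rightarrow> complex" where
  "frac_integral \<eta> \<sigma> f x = integral {0<..<x} (frac_integrand \<eta> \<sigma> f x)"

definition weighted_deriv :: "real \<Rightarrow> (real \<Rightarrow> complex) \<Rightarrow> real \<Rightarrow> complex" where
  "weighted_deriv \<eta> g x = of_real (x powr (1 - \<eta>)) * vector_derivative g (at x)"

definition frac_deriv :: "real \<Rightarrow> complex \<Rightarrow> (real \<Rightarrow> complex) \<Rightarrow> real \<Rightarrow> complex" where
  "frac_deriv \<eta> \<sigma> f x =
     of_real \<eta> powr (\<sigma> - of_nat (frac_order \<sigma>) + 1) / Gamma (of_nat (frac_order \<sigma>) - \<sigma>) *
     (weighted_deriv \<eta> ^^ frac_order \<sigma>) (frac_integral \<eta> \<sigma> f) x"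

text \<open>
  Functions are total, so the set \<open>D\<close> records where \<open>f\<close> is genuinely defined.
  The \<open>n\<close>-th iterated derivative exists at \<open>x\<close> iff the lower ones exist in a neighbourhood
  of \<open>x\<close> and the last differentiation is possible at \<open>x\<close> itself.
\<close>

definition frac_deriv_defined ::
  "real \<Rightarrow> complex \<Rightarrow> real set \<Rightarrow> (real \<Rightarrow> complex) \<Rightarrow> real \<Rightarrow> bool" where
  "frac_deriv_defined \<eta> \<sigma> D f x \<longleftrightarrow>
     (\<exists>b>x. {0<..<b} \<subseteq> D) \<and>
     (\<forall>\<^sub>F y in nhds x. frac_integrand \<eta> \<sigma> f y absolutely_integrable_on {0<..<y}) \<and>
     (\<forall>j. Suc j < frac_order \<sigma> \<longrightarrow>
        (\<forall>\<^sub>F y in nhds x. (weighted_deriv \<eta> ^^ j) (frac_integral \<eta> \<sigma> f) differentiable at y)) \<and>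
     (weighted_deriv \<eta> ^^ (frac_order \<sigma> - 1)) (frac_integral \<eta> \<sigma> f) differentiable at x"

definition beta_integrand :: "(real \<Rightarrow> complex) \<Rightarrow> complex \<Rightarrow> complex \<Rightarrow> real \<Rightarrow> complex" where
  "beta_integrand g l m z = of_real z powr (l - 1) * of_real (1 - z) powr (m - 1) * g z"

definition beta_transform :: "(real \<Rightarrow> complex) \<Rightarrow> complex \<Rightarrow> complex \<Rightarrow> complex" where
  "beta_transform g l m = integral {0<..<1} (beta_integrand g l m)"

end

theory Submission
  imports Defs "HOL-Complex_Analysis.Cauchy_Integral_Theorem"
begin

text \<open>
  Let \<open>c n\<close> be the coefficients of the \<open>k\<close>-Mittag-Leffler series, so that the operator acts on
  \<open>t powr \<mu> * (\<Sum>n. c n * (t * z) powr (\<nu> * n))\<close>. With \<open>p n = \<mu> / \<eta> + 1 + (\<nu> / \<eta>) * n\<close>, the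
  fractional derivative multiplies the \<open>n\<close>-th term by a constant times
  \<open>Gamma (p n) / Gamma (p n - \<sigma>)\<close>: the fractional integral of a power is a Beta integral, and each
  derivative shifts the argument of \<open>1 / Gamma\<close> by one. The Beta transform in \<open>z\<close> multiplies the term
  by \<open>Beta (l + \<nu> * n) m\<close>. The product of these Gamma quotients is the \<open>n\<close>-th term of the Fox-Wright
  series. What has to be justified is that both operations may be carried out termwise.

  For the derivative this is a matter of power series (\<open>frac_deriv_powser\<close>): for \<open>z < 1\<close> the series
  converges up to some \<open>b > x\<close>, so near \<open>x\<close> everything happens strictly inside the disc of
  convergence.

  The Beta transform is more delicate, because \<open>x powr \<nu>\<close> may lie on the boundary of the disc of
  convergence. Then the integrand is not controlled as \<open>z\<close> approaches \<open>1\<close>; all that is known is that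
  the gauge integral exists and that the Fox-Wright series converges. Both values are limits, as
  \<open>\<rho>\<close> tends to \<open>1\<close>, of one and the same quantity, the integral of the Beta integrand over
  \<open>{0<..<\<rho>}\<close> with the cutoff \<open>((\<rho> - u) / (1 - u)) powr m\<close> (\<open>integral_beta_powser\<close>).

  On the one hand, integration by parts writes it as an average of the indefinite integral, with
  weights concentrating at \<open>1\<close> (\<open>tendsto_integral_cut\<close>). On the other hand, for \<open>\<rho> < 1\<close> it may be
  integrated termwise, and Fubini's theorem on a triangle (\<open>beta_smoothing\<close>) writes it as an average
  of the Abel means of the series, again with weights concentrating at \<open>1\<close>; by Abel's theorem these
  means tend to the sum. The cutoff is chosen so that both sets of weights are derivatives of
  powers of Moebius maps, and one lemma on approximate identities
  (\<open>approximate_identity_at_left\<close>) handles both limits.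
\<close>

section \<open>Measurability and absolute integrability\<close>

lemma borel_measurable_cpowr [measurable]:
  fixes f g :: "'a \<Rightarrow> complex"
  assumes [measurable]: "f \<in> borel_measurable M" "g \<in> borel_measurable M"
  shows "(\<lambda>x. f x powr g x) \<in> borel_measurable M"
  unfolding powr_def by measurable

text \<open>
  Fubini's theorem is applied over \<open>lborel\<close>, while the fractional and Beta integrals are gauge
  integrals; this lemma and the next pass between the two.
\<close>
lemma absolutely_integrable_imp_lborel:
  fixes f :: "real \<Rightarrow> 'a::euclidean_space"
  assumes f: "f absolutely_integrable_on S"
    and m: "(\<lambda>x. indicator S x *\<^sub>R f x) \<in> borel_measurable borel"
  shows "integrable lborel (\<lambda>x. indicator S x *\<^sub>R f x)"
    and "(LINT x|lborel. indicator S x *\<^sub>R f x) = integral S f"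
proof -
  have m': "(\<lambda>x. indicator S x *\<^sub>R f x) \<in> borel_measurable lborel"
    using m by simp
  have "integrable lebesgue (\<lambda>x. indicator S x *\<^sub>R f x)"
    using f unfolding set_integrable_def .
  then show "integrable lborel (\<lambda>x. indicator S x *\<^sub>R f x)"
    using integrable_completion[OF m'] by simp
  have "(LINT x|lborel. indicator S x *\<^sub>R f x) = (LINT x|lebesgue. indicator S x *\<^sub>R f x)"
    using integral_completion[OF m'] by simp
  also have "\<dots> = integral S f"
    using set_lebesgue_integral_eq_integral(2)[OF f] unfolding set_lebesgue_integral_def .
  finally show "(LINT x|lborel. indicator S x *\<^sub>R f x) = integral S f" .
qed

lemma lborel_imp_absolutely_integrable:
  fixes f :: "real \<Rightarrow> 'a::euclidean_space"
  assumes f: "integrable lborel (\<lambda>x. indicator S x *\<^sub>R f x)"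
  shows "f absolutely_integrable_on S"
    and "(LINT x|lborel. indicator S x *\<^sub>R f x) = integral S f"
proof -
  have m': "(\<lambda>x. indicator S x *\<^sub>R f x) \<in> borel_measurable lborel"
    using f by (rule borel_measurable_integrable)
  have "integrable lebesgue (\<lambda>x. indicator S x *\<^sub>R f x)"
    using integrable_completion[OF m'] f by simp
  then show "f absolutely_integrable_on S"
    unfolding set_integrable_def .
  have f': "set_integrable lborel S f" using f unfolding set_integrable_def .
  show "(LINT x|lborel. indicator S x *\<^sub>R f x) = integral S f"
    using set_borel_integral_eq_integral(2)[OF f'] unfolding set_lebesgue_integral_def .
qed

lemma continuous_bounded_imp_absolutely_integrable:
  fixes f :: "real \<Rightarrow> 'a::euclidean_space"
  assumes "continuous_on S f" "S \<in> sets lebesgue" "g integrable_on S"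
    and "\<And>x. x \<in> S \<Longrightarrow> norm (f x) \<le> g x"
  shows "f absolutely_integrable_on S"
  using assms continuous_imp_measurable_on_sets_lebesgue
    measurable_bounded_by_integrable_imp_absolutely_integrable by blast

lemma norm_cpowr [simp]: "t > 0 \<Longrightarrow> norm (complex_of_real t powr a) = t powr Re a"
  by (simp add: norm_powr_real_powr)

section \<open>The complex Beta integral\<close>

text \<open>
  The interval length \<open>t\<close> is kept as a parameter because the kernel occurs both as a Beta integrand
  (\<open>t = 1\<close>) and as the kernel of a fractional integral up to \<open>t\<close>.
\<close>
definition beta_kernel :: "complex \<Rightarrow> complex \<Rightarrow> real \<Rightarrow> real \<Rightarrow> complex" where
  "beta_kernel a b t u = of_real u powr (a - 1) * of_real (t - u) powr (b - 1)"

lemma norm_beta_kernel: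
  "0 < u \<Longrightarrow> u < t \<Longrightarrow> norm (beta_kernel a b t u) = u powr (Re a - 1) * (t - u) powr (Re b - 1)"
  using norm_cpowr[of "t - u"] by (simp add: beta_kernel_def norm_mult del: of_real_diff)

lemma continuous_on_beta_kernel: "continuous_on {0<..<t} (beta_kernel a b t)"
  unfolding beta_kernel_def by (intro continuous_intros) (auto simp: complex_nonpos_Reals_iff)

lemma beta_kernel_absolutely_integrable_1:
  assumes "Re a > 0" "Re b > 0"
  shows "beta_kernel a b 1 absolutely_integrable_on {0<..<1}"
proof (rule continuous_bounded_imp_absolutely_integrable[OF continuous_on_beta_kernel])
  show "(\<lambda>u. u powr (Re a - 1) * (1 - u) powr (Re b - 1)) integrable_on {0<..<1}"
    using has_integral_Beta_real[OF assms] by (auto simp: has_integral_Icc_iff_Ioo integrable_on_def)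
qed (auto simp: norm_beta_kernel)

lemma beta_kernel_scale:
  assumes "Re a > 0" "Re b > 0" "t > 0"
  shows "beta_kernel a b t absolutely_integrable_on {0<..<t}"
    and "integral {0<..<t} (beta_kernel a b t) =
           of_real t powr (a + b - 1) * integral {0<..<1} (beta_kernel a b 1)"
proof -
  have im: "(\<lambda>v. t * v) ` {0<..<1} = {0<..<t}"
  proof (intro equalityI subsetI)
    fix u assume "u \<in> {0<..<t}"
    then show "u \<in> (\<lambda>v. t * v) ` {0<..<1}"
      using \<open>t > 0\<close> by (intro image_eqI[of _ _ "u / t"]) auto
  qed (use \<open>t > 0\<close> in auto)
  have eq: "\<bar>t\<bar> *\<^sub>R beta_kernel a b t (t * v) = of_real t powr (a + b - 1) * beta_kernel a b 1 v"
    if "v \<in> {0<..<1}" for v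
  proof -
    have "t - t * v = t * (1 - v)" by (simp add: algebra_simps)
    then have "beta_kernel a b t (t * v)
        = of_real (t * v) powr (a - 1) * of_real (t * (1 - v)) powr (b - 1)"
      by (simp only: beta_kernel_def)
    also have "\<dots> = (of_real t powr (a - 1) * of_real v powr (a - 1)) *
        (of_real t powr (b - 1) * of_real (1 - v) powr (b - 1))"
      using that \<open>t > 0\<close> by (simp only: of_real_mult) (subst powr_times_real | simp del: of_real_diff)+
    also have "\<dots> = (of_real t powr (a - 1) * of_real t powr (b - 1)) * beta_kernel a b 1 v"
      by (simp add: beta_kernel_def)
    also have "complex_of_real t * (of_real t powr (a - 1) * of_real t powr (b - 1)) =
        of_real t powr (a + b - 1)"
    proof -
      have "complex_of_real t = of_real t powr 1" using \<open>t > 0\<close> by simp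
      then have "complex_of_real t * (of_real t powr (a - 1) * of_real t powr (b - 1)) =
        of_real t powr 1 * (of_real t powr (a - 1) * of_real t powr (b - 1))" by simp
      also have "\<dots> = of_real t powr (1 + ((a - 1) + (b - 1)))"
        by (simp only: powr_add)
      finally show ?thesis by (simp add: algebra_simps)
    qed
    ultimately show ?thesis using \<open>t > 0\<close>
      by (simp add: scaleR_conv_of_real mult.assoc[symmetric])
  qed
  have abs1: "(\<lambda>v. of_real t powr (a + b - 1) * beta_kernel a b 1 v) absolutely_integrable_on {0<..<1}"
    using set_integrable_mult_right[of "of_real t powr (a+b-1)", OF beta_kernel_absolutely_integrable_1[OF assms(1,2)]]
    by simp
  have "(\<lambda>v. \<bar>t\<bar> *\<^sub>R beta_kernel a b t (t * v)) absolutely_integrable_on {0<..<1} \<and>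
    integral {0<..<1} (\<lambda>v. \<bar>t\<bar> *\<^sub>R beta_kernel a b t (t * v)) =
       of_real t powr (a + b - 1) * integral {0<..<1} (beta_kernel a b 1)"
  proof
    show "(\<lambda>v. \<bar>t\<bar> *\<^sub>R beta_kernel a b t (t * v)) absolutely_integrable_on {0<..<1}"
      using abs1 by (subst set_integrable_cong[OF refl refl eq])
    have "integral {0<..<1} (\<lambda>v. \<bar>t\<bar> *\<^sub>R beta_kernel a b t (t * v)) =
       integral {0<..<1} (\<lambda>v. of_real t powr (a + b - 1) * beta_kernel a b 1 v)"
      by (rule integral_cong) (rule eq)
    then show "integral {0<..<1} (\<lambda>v. \<bar>t\<bar> *\<^sub>R beta_kernel a b t (t * v)) =
       of_real t powr (a + b - 1) * integral {0<..<1} (beta_kernel a b 1)" by simp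
  qed
  moreover have "inj_on (\<lambda>v. t * v) {0<..<1}" using \<open>t > 0\<close> by (auto intro: inj_onI)
  ultimately have "beta_kernel a b t absolutely_integrable_on (\<lambda>v. t * v) ` {0<..<1} \<and>
    integral ((\<lambda>v. t * v) ` {0<..<1}) (beta_kernel a b t) =
       of_real t powr (a + b - 1) * integral {0<..<1} (beta_kernel a b 1)"
    by (subst has_absolute_integral_change_of_variables_real[symmetric, where h = "\<lambda>_. t"])
      (auto intro!: derivative_eq_intros)
  then show "beta_kernel a b t absolutely_integrable_on {0<..<t}"
    "integral {0<..<t} (beta_kernel a b t) =
           of_real t powr (a + b - 1) * integral {0<..<1} (beta_kernel a b 1)"
    unfolding im by auto
qed

lemma integral_norm_beta_kernel:
  assumes "Re a > 0" "Re b > 0" "t > 0"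
  shows "integral {0<..<t} (\<lambda>u. norm (beta_kernel a b t u)) =
           t powr (Re a + Re b - 1) * Re (integral {0<..<1} (beta_kernel (Re a) (Re b) 1))"
proof -
  have "norm (beta_kernel a b t u) = Re (beta_kernel (Re a) (Re b) t u)" if "u \<in> {0<..<t}" for u
  proof -
    have "beta_kernel (Re a) (Re b) t u = of_real (u powr (Re a - 1) * (t - u) powr (Re b - 1))"
      using that powr_of_real[of u "Re a - 1"] powr_of_real[of "t - u" "Re b - 1"]
      unfolding beta_kernel_def of_real_mult by simp
    then show ?thesis using that by (simp add: norm_beta_kernel)
  qed
  then have "integral {0<..<t} (\<lambda>u. norm (beta_kernel a b t u)) =
      integral {0<..<t} (\<lambda>u. Re (beta_kernel (Re a) (Re b) t u))"
    by (intro integral_cong) auto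
  also have "\<dots> = Re (integral {0<..<t} (beta_kernel (Re a) (Re b) t))"
    using integral_linear[OF set_lebesgue_integral_eq_integral(1)[OF
      beta_kernel_scale(1)[of "Re a" "Re b" t]] bounded_linear_Re] assms
    by (simp add: o_def)
  also have "\<dots> = Re (of_real t powr (of_real (Re a + Re b - 1)) *
       integral {0<..<1} (beta_kernel (Re a) (Re b) 1))"
    using assms by (subst beta_kernel_scale) auto
  also have "of_real t powr (of_real (Re a + Re b - 1)) = complex_of_real (t powr (Re a + Re b - 1))"
    using assms by (intro powr_of_real) auto
  finally show ?thesis by simp
qed

text \<open>
  The integrand \<open>u powr (a - 1) * (t - u) powr (b - 1) * \<phi> t\<close> on the triangle \<open>0 < u < t\<close> is
  integrated in both orders: along \<open>u\<close> first, homogeneity of the kernel produces a Beta integral times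
  a power of \<open>t\<close>. Two choices of \<open>\<phi>\<close> matter: an exponential, which evaluates the Beta integral, and
  \<open>(1 - t) powr (- m - 1)\<close> cut off at \<open>\<rho>\<close>, which gives the smoothing identity below.
\<close>
lemma beta_fubini:
  fixes \<phi> \<psi> :: "real \<Rightarrow> complex"
  assumes a: "Re a > 0" and b: "Re b > 0"
    and m [measurable]: "\<phi> \<in> borel_measurable borel"
    and int: "(\<lambda>t. of_real t powr (a + b - 1) * \<phi> t) absolutely_integrable_on {0<..}"
    and inner: "\<And>u. u > 0 \<Longrightarrow> (\<lambda>t. of_real (t - u) powr (b - 1) * \<phi> t) absolutely_integrable_on {u<..}"
    and \<psi>: "\<And>u. u > 0 \<Longrightarrow> integral {u<..} (\<lambda>t. of_real (t - u) powr (b - 1) * \<phi> t) = \<psi> u"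
  shows "(\<lambda>u. of_real u powr (a - 1) * \<psi> u) absolutely_integrable_on {0<..}"
    and "integral {0<..} (\<lambda>u. of_real u powr (a - 1) * \<psi> u) =
           integral {0<..<1} (beta_kernel a b 1) *
           integral {0<..} (\<lambda>t. of_real t powr (a + b - 1) * \<phi> t)"
proof -
  define K where "K t u = (if 0 < u \<and> u < t then beta_kernel a b t u * \<phi> t else 0)" for t u
  have mK: "(\<lambda>(t, u). K t u) \<in> borel_measurable (lborel \<Otimes>\<^sub>M lborel)"
    unfolding K_def beta_kernel_def by measurable
  have Kt: "K t u = \<phi> t * (indicator {0<..<t} u *\<^sub>R beta_kernel a b t u)" for t u
    by (auto simp: K_def indicator_def)
  have Ku: "K t u = of_real u powr (a - 1) * (indicator {u<..} t *\<^sub>R (of_real (t - u) powr (b - 1) * \<phi> t))"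
    if "u > 0" for t u
    using that by (auto simp: K_def indicator_def beta_kernel_def)
  have K0: "K t u = 0" if "t \<le> 0 \<or> u \<le> 0" for t u
    using that by (auto simp: K_def)
  have mbk: "(\<lambda>u. indicator {0<..<t} u *\<^sub>R beta_kernel a b t u) \<in> borel_measurable borel" for t
    unfolding beta_kernel_def by measurable
  have bk: "integrable lborel (\<lambda>u. indicator {0<..<t} u *\<^sub>R beta_kernel a b t u)"
    "(LINT u|lborel. indicator {0<..<t} u *\<^sub>R beta_kernel a b t u)
       = of_real t powr (a + b - 1) * integral {0<..<1} (beta_kernel a b 1)"
    "(LINT u|lborel. norm (indicator {0<..<t} u *\<^sub>R beta_kernel a b t u)) =
       t powr (Re a + Re b - 1) * Re (integral {0<..<1} (beta_kernel (Re a) (Re b) 1))"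
    if "t > 0" for t
  proof -
    note * = absolutely_integrable_imp_lborel[OF beta_kernel_scale(1)[OF a b that] mbk]
    show "integrable lborel (\<lambda>u. indicator {0<..<t} u *\<^sub>R beta_kernel a b t u)" by (rule *)
    show "(LINT u|lborel. indicator {0<..<t} u *\<^sub>R beta_kernel a b t u)
       = of_real t powr (a + b - 1) * integral {0<..<1} (beta_kernel a b 1)"
      using *(2) beta_kernel_scale(2)[OF a b that] by simp
    have n: "(\<lambda>u. norm (indicator {0<..<t} u *\<^sub>R beta_kernel a b t u)) =
       (\<lambda>u. indicator {0<..<t} u *\<^sub>R norm (beta_kernel a b t u))" by auto
    have "integrable lborel (\<lambda>u. norm (indicator {0<..<t} u *\<^sub>R beta_kernel a b t u))"
      by (intro integrable_norm *)
    then show "(LINT u|lborel. norm (indicator {0<..<t} u *\<^sub>R beta_kernel a b t u)) =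
       t powr (Re a + Re b - 1) * Re (integral {0<..<1} (beta_kernel (Re a) (Re b) 1))"
      unfolding n using lborel_imp_absolutely_integrable(2)[of "{0<..<t}" "\<lambda>u. norm (beta_kernel a b t u)"]
      by (simp add: integral_norm_beta_kernel[OF a b that])
  qed
  have mt: "(\<lambda>t. indicator {0<..} t *\<^sub>R (of_real t powr (a + b - 1) * \<phi> t)) \<in> borel_measurable borel"
    by measurable
  note int' = absolutely_integrable_imp_lborel[OF int mt]
  have L1: "(LINT u|lborel. K t u) = integral {0<..<1} (beta_kernel a b 1) *
      (indicator {0<..} t *\<^sub>R (of_real t powr (a + b - 1) * \<phi> t))" for t
  proof (cases "t > 0")
    case True
    have "(LINT u|lborel. K t u) = \<phi> t * (LINT u|lborel. indicator {0<..<t} u *\<^sub>R beta_kernel a b t u)"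
      unfolding Kt by (rule integral_mult_right_zero)
    then show ?thesis using True by (simp add: bk(2))
  qed (simp add: K0)
  have N1: "(LINT u|lborel. norm (K t u)) = Re (integral {0<..<1} (beta_kernel (Re a) (Re b) 1)) *
      norm (indicator {0<..} t *\<^sub>R (of_real t powr (a + b - 1) * \<phi> t))" for t
  proof (cases "t > 0")
    case True
    have "(LINT u|lborel. norm (K t u)) =
        norm (\<phi> t) * (LINT u|lborel. norm (indicator {0<..<t} u *\<^sub>R beta_kernel a b t u))"
      unfolding Kt norm_mult[of "\<phi> t"] by (rule integral_mult_right_zero)
    also have "\<dots> = norm (\<phi> t) * (t powr (Re a + Re b - 1) * Re (integral {0<..<1} (beta_kernel (Re a) (Re b) 1)))"
      by (simp only: bk(3)[OF True])
    finally show ?thesis using True by (simp add: norm_mult)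
  qed (simp add: K0)
  have intK: "integrable (lborel \<Otimes>\<^sub>M lborel) (\<lambda>(t, u). K t u)"
  proof (rule lborel_pair.Fubini_integrable[OF mK])
    show "integrable lborel (\<lambda>t. LINT u|lborel. norm (case (t, u) of (t, u) \<Rightarrow> K t u))"
      unfolding prod.case N1 by (intro integrable_mult_right integrable_norm int')
    have "integrable lborel (K t)" for t
    proof (cases "t > 0")
      case True
      then show ?thesis unfolding Kt[abs_def] by (intro integrable_mult_right bk)
    next
      case False
      then have "K t = (\<lambda>_. 0)" by (simp add: K0 fun_eq_iff)
      then show ?thesis by simp
    qed
    then show "AE t in lborel. integrable lborel (\<lambda>u. case (t, u) of (t, u) \<Rightarrow> K t u)" by simp
  qed
  have L2: "(LINT t|lborel. K t u) = indicator {0<..} u *\<^sub>R (of_real u powr (a - 1) * \<psi> u)" for u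
  proof (cases "u > 0")
    case True
    have "(\<lambda>t. indicator {u<..} t *\<^sub>R (of_real (t - u) powr (b - 1) * \<phi> t)) \<in> borel_measurable borel"
      by measurable
    note absolutely_integrable_imp_lborel(2)[OF inner[OF True] this]
    moreover have "(LINT t|lborel. K t u) = of_real u powr (a - 1) *
        (LINT t|lborel. indicator {u<..} t *\<^sub>R (of_real (t - u) powr (b - 1) * \<phi> t))"
      unfolding Ku[OF True] by (rule integral_mult_right_zero)
    ultimately show ?thesis using True \<psi>[OF True] by simp
  qed (simp add: K0)
  have "integrable lborel (\<lambda>u. LINT t|lborel. K t u)"
    using lborel_pair.integrable_snd[OF intK] .
  then have *: "integrable lborel (\<lambda>u. indicator {0<..} u *\<^sub>R (of_real u powr (a - 1) * \<psi> u))"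
    unfolding L2 .
  from lborel_imp_absolutely_integrable(1)[OF *]
  show "(\<lambda>u. of_real u powr (a - 1) * \<psi> u) absolutely_integrable_on {0<..}" .
  have "integral {0<..} (\<lambda>u. of_real u powr (a - 1) * \<psi> u) = (LINT u|lborel. LINT t|lborel. K t u)"
    unfolding L2 using lborel_imp_absolutely_integrable(2)[OF *] by simp
  also have "\<dots> = (LINT t|lborel. LINT u|lborel. K t u)"
    by (rule lborel_pair.Fubini_integral[OF intK])
  also have "\<dots> = integral {0<..<1} (beta_kernel a b 1) *
           integral {0<..} (\<lambda>t. of_real t powr (a + b - 1) * \<phi> t)"
    unfolding L1 int'(2)[symmetric] by (rule integral_mult_right_zero)
  finally show "integral {0<..} (\<lambda>u. of_real u powr (a - 1) * \<psi> u) =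
           integral {0<..<1} (beta_kernel a b 1) *
           integral {0<..} (\<lambda>t. of_real t powr (a + b - 1) * \<phi> t)" .
qed

lemma Re_pos_not_nonpos_Ints: "Re z > 0 \<Longrightarrow> z \<notin> \<int>\<^sub>\<le>\<^sub>0"
  by (auto elim!: nonpos_Ints_cases)

text \<open>
  With \<open>\<phi> t = exp (- t)\<close> the inner integral is a shifted Gamma integral and the outer one another
  Gamma integral, so the two orders of integration give \<open>Gamma a * Gamma b\<close> on one side and
  \<open>Gamma (a + b)\<close> times the Beta integral on the other.
\<close>
lemma integral_beta_kernel:
  assumes a: "Re a > 0" and b: "Re b > 0"
  shows "integral {0<..<1} (beta_kernel a b 1) = Beta a b"
proof -
  define \<phi> :: "real \<Rightarrow> complex" where "\<phi> = (\<lambda>t. of_real (exp (- t)))"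
  have G: "(\<lambda>t. of_real t powr (c - 1) * \<phi> t) absolutely_integrable_on {0<..}"
     "integral {0<..} (\<lambda>t. of_real t powr (c - 1) * \<phi> t) = Gamma c" if "Re c > 0" for c
  proof -
    have *: "(\<lambda>t. of_real t powr (c - 1) * \<phi> t) = (\<lambda>t. of_real t powr (c - 1) / of_real (exp t))"
      by (simp add: \<phi>_def exp_minus field_simps)
    show "(\<lambda>t. of_real t powr (c - 1) * \<phi> t) absolutely_integrable_on {0<..}"
     "integral {0<..} (\<lambda>t. of_real t powr (c - 1) * \<phi> t) = Gamma c"
      unfolding * using absolutely_integrable_Gamma_integral'[OF that]
        Gamma_integral_complex'[OF that] by (auto simp: integral_unique)
  qed
  have S: "(\<lambda>t. of_real (t - u) powr (b - 1) * \<phi> t) absolutely_integrable_on {u<..} \<and>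
     integral {u<..} (\<lambda>t. of_real (t - u) powr (b - 1) * \<phi> t) = \<phi> u * Gamma b" for u
  proof -
    have im: "(\<lambda>t. t + u) ` {0<..} = {u<..}"
    proof (intro equalityI subsetI)
      fix t assume "t \<in> {u<..}"
      then show "t \<in> (\<lambda>t. t + u) ` {0<..}" by (intro image_eqI[of _ _ "t - u"]) auto
    qed auto
    have "\<bar>1\<bar> *\<^sub>R (of_real (t + u - u) powr (b - 1) * \<phi> (t + u)) = \<phi> u * (of_real t powr (b - 1) * \<phi> t)" for t
      by (simp add: \<phi>_def exp_add exp_minus field_simps)
    note eq = this
    have "(\<lambda>t. \<bar>1\<bar> *\<^sub>R (of_real (t + u - u) powr (b - 1) * \<phi> (t + u))) absolutely_integrable_on {0<..} \<and>
      integral {0<..} (\<lambda>t. \<bar>1\<bar> *\<^sub>R (of_real (t + u - u) powr (b - 1) * \<phi> (t + u))) = \<phi> u * Gamma b"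
      unfolding eq using G[OF b] by simp
    then show ?thesis
      by (subst (asm) has_absolute_integral_change_of_variables_real[where g = "\<lambda>t. t + u"])
        (auto simp: im intro!: derivative_eq_intros inj_onI)
  qed
  have "integral {0<..} (\<lambda>u. of_real u powr (a - 1) * (\<phi> u * Gamma b)) =
      integral {0<..<1} (beta_kernel a b 1) *
      integral {0<..} (\<lambda>t. of_real t powr (a + b - 1) * \<phi> t)"
    using S a b by (intro beta_fubini G(1)) (auto simp: \<phi>_def)
  moreover have "integral {0<..} (\<lambda>u. of_real u powr (a - 1) * (\<phi> u * Gamma b)) = Gamma a * Gamma b"
    using G(2)[OF a] integral_mult_left[of "{0<..}" "\<lambda>u. of_real u powr (a - 1) * \<phi> u" "Gamma b"]
    by (simp add: mult.assoc)
  moreover have "Gamma (a + b) \<noteq> 0"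
    using Re_pos_not_nonpos_Ints[of "a + b"] a b by (simp add: Gamma_eq_zero_iff)
  ultimately show ?thesis using G(2)[of "a + b"] a b
    by (simp add: Beta_def field_simps)
qed


lemma beta_kernel_integral:
  assumes "Re a > 0" "Re b > 0" "t > 0"
  shows "integral {0<..<t} (beta_kernel a b t) = of_real t powr (a + b - 1) * Beta a b"
  unfolding beta_kernel_scale(2)[OF assms] integral_beta_kernel[OF assms(1,2)] ..

section \<open>The smoothing identity for Beta integrals\<close>

lemma continuous_on_cpowr_const:
  fixes X :: "real \<Rightarrow> real"
  assumes "continuous_on S X" "\<And>t. t \<in> S \<Longrightarrow> X t \<ge> 0" "Re m > 0"
  shows "continuous_on S (\<lambda>t. complex_of_real (X t) powr m)"
  using assms by (intro continuous_on_powr_complex continuous_intros) auto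

lemma has_vector_derivative_cpowr:
  fixes X :: "real \<Rightarrow> real"
  assumes "(X has_real_derivative X') (at t)" "X t > 0"
  shows "((\<lambda>t. complex_of_real (X t) powr m) has_vector_derivative
           (m * of_real (X t) powr (m - 1) * of_real X')) (at t)"
proof -
  have "((\<lambda>t. complex_of_real (X t)) has_vector_derivative of_real X') (at t)"
    using assms(1) by (intro has_vector_derivative_of_real) (simp add: has_real_derivative_iff_has_vector_derivative)
  moreover have "((\<lambda>z. z powr m) has_field_derivative m * of_real (X t) powr (m - 1)) (at (of_real (X t)))"
    using assms(2) by (intro has_field_derivative_powr) (auto simp: complex_nonpos_Reals_iff)
  ultimately show ?thesis
    using field_vector_diff_chain_at[of "\<lambda>t. complex_of_real (X t)" "of_real X'" t "\<lambda>z. z powr m"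
      "m * of_real (X t) powr (m - 1)"]
    unfolding o_def by (simp only: mult.commute)
qed

text \<open>
  The antiderivative is \<open>X powr m / m\<close>, which stays continuous where \<open>X\<close> vanishes at an endpoint
  because \<open>Re m > 0\<close>. The sign \<open>s\<close> of \<open>X'\<close> makes the modulus of the integrand again a derivative,
  which gives absolute integrability even when the exponent \<open>m - 1\<close> is singular.
\<close>
lemma has_integral_cpowr_deriv:
  fixes X X' :: "real \<Rightarrow> real"
  assumes m: "Re m > 0" and le: "a \<le> b"
    and X: "continuous_on {a..b} X" "\<And>t. t \<in> {a..b} \<Longrightarrow> X t \<ge> 0" "\<And>t. t \<in> {a<..<b} \<Longrightarrow> X t > 0"
    and X': "\<And>t. t \<in> {a<..<b} \<Longrightarrow> (X has_real_derivative X' t) (at t)" "continuous_on {a<..<b} X'"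
      "\<And>t. t \<in> {a<..<b} \<Longrightarrow> \<bar>X' t\<bar> = s * X' t"
  shows "(\<lambda>t. of_real (X t) powr (m - 1) * of_real (X' t)) absolutely_integrable_on {a<..<b}"
    and "((\<lambda>t. of_real (X t) powr (m - 1) * of_real (X' t)) has_integral
            (of_real (X b) powr m - of_real (X a) powr m) / m) {a<..<b}"
    and "((\<lambda>t. norm (of_real (X t) powr (m - 1) * complex_of_real (X' t))) has_integral
            s * (X b powr Re m - X a powr Re m) / Re m) {a<..<b}"
proof -
  have m0: "m \<noteq> 0" using m by auto
  have "((\<lambda>t. of_real (X t) powr (m - 1) * of_real (X' t)) has_integral
            (of_real (X b) powr m / m - of_real (X a) powr m / m)) {a..b}"
  proof (rule fundamental_theorem_of_calculus_interior[OF le])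
    show "continuous_on {a..b} (\<lambda>t. complex_of_real (X t) powr m / m)"
      using m0 by (intro continuous_intros continuous_on_cpowr_const X m) auto
    fix t assume t: "t \<in> {a<..<b}"
    have "((\<lambda>t. complex_of_real (X t) powr m / m) has_vector_derivative
      (m * of_real (X t) powr (m - 1) * of_real (X' t)) / m) (at t)"
      by (intro has_vector_derivative_divide has_vector_derivative_cpowr X X' t)
    then show "((\<lambda>t. complex_of_real (X t) powr m / m) has_vector_derivative
        of_real (X t) powr (m - 1) * of_real (X' t)) (at t)" using m0 by simp
  qed
  then show I: "((\<lambda>t. of_real (X t) powr (m - 1) * of_real (X' t)) has_integral
            (of_real (X b) powr m - of_real (X a) powr m) / m) {a<..<b}"
    by (simp add: has_integral_Icc_iff_Ioo diff_divide_distrib)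
  have "((\<lambda>t. s * (X t powr (Re m - 1) * X' t)) has_integral
            (s * X b powr Re m / Re m - s * X a powr Re m / Re m)) {a..b}"
  proof (rule fundamental_theorem_of_calculus_interior[OF le])
    show "continuous_on {a..b} (\<lambda>t. s * X t powr Re m / Re m)"
      using m X by (intro continuous_intros continuous_on_powr') force+
    fix t assume t: "t \<in> {a<..<b}"
    have "((\<lambda>t. s * X t powr Re m / Re m) has_real_derivative s * (X t powr (Re m - 1) * X' t)) (at t)"
      using X(3)[OF t] m X'(1)[OF t] by (auto intro!: derivative_eq_intros)
    then show "((\<lambda>t. s * X t powr Re m / Re m) has_vector_derivative s * (X t powr (Re m - 1) * X' t)) (at t)"
      by (simp add: has_real_derivative_iff_has_vector_derivative)
  qed
  then have J: "((\<lambda>t. s * (X t powr (Re m - 1) * X' t)) has_integral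
            s * (X b powr Re m - X a powr Re m) / Re m) {a<..<b}"
    by (simp add: has_integral_Icc_iff_Ioo diff_divide_distrib right_diff_distrib)
  have n: "norm (of_real (X t) powr (m - 1) * complex_of_real (X' t)) = s * (X t powr (Re m - 1) * X' t)"
    if "t \<in> {a<..<b}" for t
    using X(3)[OF that] X'(3)[OF that] by (simp add: norm_mult)
  show K: "((\<lambda>t. norm (of_real (X t) powr (m - 1) * complex_of_real (X' t))) has_integral
            s * (X b powr Re m - X a powr Re m) / Re m) {a<..<b}"
    using n by (intro has_integral_eq[OF _ J]) auto
  from I K show "(\<lambda>t. of_real (X t) powr (m - 1) * of_real (X' t)) absolutely_integrable_on {a<..<b}"
    unfolding absolutely_integrable_on_def by (auto simp: integrable_on_def)
qed

lemma cpowr_ratio: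
  assumes "x > 0" "y > 0"
  shows "complex_of_real (x / y) powr m = of_real x powr m * of_real y powr (- m)"
proof -
  have "complex_of_real (x / y) powr m = (of_real x * of_real (inverse y)) powr m"
    by (simp add: divide_inverse)
  also have "\<dots> = of_real x powr m * of_real (inverse y) powr m"
    using assms by (intro powr_times_real) auto
  also have "complex_of_real (inverse y) powr m = of_real y powr (- m)"
    using assms by (simp add: powr_def Ln_of_real ln_inverse flip: of_real_inverse)
  finally show ?thesis .
qed

text \<open>
  The right-hand side is the inner integrand of the Fubini argument; the left-hand side is
  \<open>X powr (m - 1)\<close> times the derivative of \<open>X\<close>, up to the factor \<open>1 - u\<close>, for
  \<open>X t = (t - u) / (1 - t)\<close>.
\<close>
lemma moebius_cpowr:
  assumes "u < t" "t < 1"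
  shows "complex_of_real ((t - u) / (1 - t)) powr (m - 1) * of_real (1 / (1 - t)^2)
     = of_real (t - u) powr (m - 1) * of_real (1 - t) powr (- m - 1)"
proof -
  have "complex_of_real (1 / (1 - t)^2) = of_real (1 - t) powr (-2)"
    using assms by (simp add: powr_minus powr_numeral divide_inverse flip: of_real_diff)
  moreover have "complex_of_real (1 - t) powr (- (m - 1)) * of_real (1 - t) powr (-2) = of_real (1 - t) powr (- m - 1)"
    by (simp only: powr_add[symmetric]) (rule arg_cong[where f = "\<lambda>c. of_real (1 - t) powr c"], simp)
  ultimately show ?thesis using assms cpowr_ratio[of "t - u" "1 - t" "m - 1"]
    by (simp add: mult.assoc del: of_real_diff)
qed

text \<open>
  Up to constants the integrand is the derivative of the \<open>m\<close>-th power of the Moebius map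
  \<open>t \<mapsto> (t - u) / (1 - t)\<close>; this is the reason for the exponent \<open>- m - 1\<close>.
\<close>
lemma beta_smoothing_inner:
  assumes m: "Re m > 0" and r: "u \<le> \<rho>" "\<rho> < 1"
  shows "(\<lambda>t. of_real (t - u) powr (m - 1) * of_real (1 - t) powr (- m - 1)) absolutely_integrable_on {u<..<\<rho>}"
    and "integral {u<..<\<rho>} (\<lambda>t. of_real (t - u) powr (m - 1) * of_real (1 - t) powr (- m - 1)) =
       of_real ((\<rho> - u) / (1 - \<rho>)) powr m / (m * of_real (1 - u))"
proof -
  define X where "X t = (t - u) / (1 - t)" for t
  define X' where "X' t = (1 - u) / (1 - t)^2" for t
  have d: "(X has_real_derivative X' t) (at t)" if "t \<in> {u<..<\<rho>}" for t
    unfolding X_def X'_def using that r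
    by (auto intro!: derivative_eq_intros simp: field_simps power2_eq_square)
  have c: "continuous_on {u..\<rho>} X" "continuous_on {u<..<\<rho>} X'"
    unfolding X_def X'_def using r by (auto intro!: continuous_intros)
  note F = has_integral_cpowr_deriv[OF m r(1) c(1) _ _ d c(2), where s = 1]
  have F1: "(\<lambda>t. of_real (X t) powr (m - 1) * of_real (X' t)) absolutely_integrable_on {u<..<\<rho>}"
    by (rule F) (use r in \<open>auto simp: X_def X'_def\<close>)
  have F2: "((\<lambda>t. of_real (X t) powr (m - 1) * of_real (X' t)) has_integral
            (of_real (X \<rho>) powr m - of_real (X u) powr m) / m) {u<..<\<rho>}"
    by (rule F) (use r in \<open>auto simp: X_def X'_def\<close>)
  have e: "of_real (t - u) powr (m - 1) * of_real (1 - t) powr (- m - 1)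
     = of_real (1 / (1 - u)) * (of_real (X t) powr (m - 1) * complex_of_real (X' t))" if "t \<in> {u<..<\<rho>}" for t
    using moebius_cpowr[of u t m] that r by (simp add: X_def X'_def)
  show "(\<lambda>t. of_real (t - u) powr (m - 1) * of_real (1 - t) powr (- m - 1)) absolutely_integrable_on {u<..<\<rho>}"
    using F1 by (subst set_integrable_cong[OF refl refl e]) auto
  have "integral {u<..<\<rho>} (\<lambda>t. of_real (t - u) powr (m - 1) * of_real (1 - t) powr (- m - 1)) =
    integral {u<..<\<rho>} (\<lambda>t. of_real (1 / (1 - u)) * (of_real (X t) powr (m - 1) * complex_of_real (X' t)))"
    by (rule integral_cong) (rule e)
  also have "\<dots> = of_real (1 / (1 - u)) * ((of_real (X \<rho>) powr m - of_real (X u) powr m) / m)"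
    using F2 by (simp add: integral_unique)
  finally show "integral {u<..<\<rho>} (\<lambda>t. of_real (t - u) powr (m - 1) * of_real (1 - t) powr (- m - 1)) =
       of_real ((\<rho> - u) / (1 - \<rho>)) powr m / (m * of_real (1 - u))"
    by (simp add: X_def field_simps)
qed

lemma smoothing_kernel_absolutely_integrable:
  assumes "Re a > 0" "0 < \<rho>" "\<rho> < 1"
  shows "(\<lambda>t. of_real t powr (a - 1) * of_real (1 - t) powr m) absolutely_integrable_on {0<..<\<rho>}"
proof -
  have "bounded ((\<lambda>t. complex_of_real (1 - t) powr m) ` {0..\<rho>})"
    using assms by (intro compact_imp_bounded compact_continuous_image continuous_intros)
      (auto simp: complex_nonpos_Reals_iff)
  then obtain B where B: "\<And>t. t \<in> {0..\<rho>} \<Longrightarrow> norm (complex_of_real (1 - t) powr m) \<le> B"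
    unfolding bounded_iff by blast
  show ?thesis
  proof (rule continuous_bounded_imp_absolutely_integrable)
    show "continuous_on {0<..<\<rho>} (\<lambda>t. of_real t powr (a - 1) * complex_of_real (1 - t) powr m)"
      using assms by (intro continuous_intros) (auto simp: complex_nonpos_Reals_iff)
    have "(\<lambda>t. t powr (Re a - 1)) integrable_on {0..\<rho>}"
      using assms by (intro integrable_on_powr_from_0) auto
    then show "(\<lambda>t. t powr (Re a - 1) * B) integrable_on {0<..<\<rho>}"
      by (intro integrable_on_mult_left) (simp add: integrable_on_Icc_iff_Ioo)
    fix t assume t: "t \<in> {0<..<\<rho>}"
    then show "norm (of_real t powr (a - 1) * complex_of_real (1 - t) powr m) \<le> t powr (Re a - 1) * B"
      unfolding norm_mult using B[of t] by (intro mult_mono) auto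
  qed auto
qed

text \<open>
  Read from right to left: averaging the powers \<open>t powr (a + m - 1)\<close>, each weighted with its Beta
  value, against \<open>(1 - t) powr (- m - 1)\<close> on \<open>{0<..<\<rho>}\<close> is the same as multiplying the Beta integrand
  \<open>u powr (a - 1) * (1 - u) powr (m - 1)\<close> by the cutoff \<open>((\<rho> - u) / (1 - u)) powr m\<close> and
  integrating; on the left this product is already expanded. The cutoff does not depend on \<open>a\<close>, so the identity extends from powers to power series.
\<close>
lemma beta_smoothing:
  assumes a: "Re a > 0" and m: "Re m > 0" and r: "0 < \<rho>" "\<rho> < 1"
  shows "integral {0<..<\<rho>} (\<lambda>u. of_real u powr (a - 1) * of_real (\<rho> - u) powr m / of_real (1 - u)) =
     m * of_real (1 - \<rho>) powr m * Beta a m *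
       integral {0<..<\<rho>} (\<lambda>t. of_real t powr (a + m - 1) * of_real (1 - t) powr (- m - 1))"
proof -
  define \<phi> :: "real \<Rightarrow> complex" where "\<phi> t = indicator {..<\<rho>} t * of_real (1 - t) powr (- m - 1)" for t
  define \<psi> :: "real \<Rightarrow> complex" where
    "\<psi> u = indicator {..<\<rho>} u * (of_real ((\<rho> - u) / (1 - \<rho>)) powr m / (m * of_real (1 - u)))" for u
  have m0: "m \<noteq> 0" using m by auto
  have cut: "(\<lambda>t. f t * \<phi> t) absolutely_integrable_on {u<..} \<longleftrightarrow>
       (\<lambda>t. f t * of_real (1 - t) powr (- m - 1)) absolutely_integrable_on {u<..<\<rho>}"
     "integral {u<..} (\<lambda>t. f t * \<phi> t) =
       integral {u<..<\<rho>} (\<lambda>t. f t * of_real (1 - t) powr (- m - 1))" for f :: "real \<Rightarrow> complex" and u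
  proof -
    have i: "{..<\<rho>} \<inter> {u<..} = {u<..<\<rho>}" by auto
    have e: "f t * \<phi> t = (if t \<in> {..<\<rho>} then f t * of_real (1 - t) powr (- m - 1) else 0)" for t
      by (simp add: \<phi>_def)
    show "(\<lambda>t. f t * \<phi> t) absolutely_integrable_on {u<..} \<longleftrightarrow>
       (\<lambda>t. f t * of_real (1 - t) powr (- m - 1)) absolutely_integrable_on {u<..<\<rho>}"
      unfolding set_integrable_def \<phi>_def
      by (intro arg_cong[where f = "integrable lebesgue"] ext) (auto simp: indicator_def)
    show "integral {u<..} (\<lambda>t. f t * \<phi> t) =
       integral {u<..<\<rho>} (\<lambda>t. f t * of_real (1 - t) powr (- m - 1))"
      unfolding e by (subst integral_restrict_Int) (simp add: i)
  qed
  have meas: "\<phi> \<in> borel_measurable borel" unfolding \<phi>_def by measurable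
  have "Re (a + m) > 0" using a m by simp
  then have i1: "(\<lambda>t. of_real t powr (a + m - 1) * \<phi> t) absolutely_integrable_on {0<..}"
    unfolding cut using r by (intro smoothing_kernel_absolutely_integrable) auto
  have i2: "(\<lambda>t. of_real (t - u) powr (m - 1) * \<phi> t) absolutely_integrable_on {u<..} \<and>
     integral {u<..} (\<lambda>t. of_real (t - u) powr (m - 1) * \<phi> t) = \<psi> u" for u
  proof (cases "u < \<rho>")
    case True
    then show ?thesis unfolding cut \<psi>_def
      using beta_smoothing_inner[OF m, of u \<rho>] r by simp
  next
    case False
    then have "{u<..<\<rho>} = {}" by auto
    then show ?thesis unfolding cut \<psi>_def using False by (simp add: set_integrable_def)
  qed
  have "integral {0<..} (\<lambda>u. of_real u powr (a - 1) * \<psi> u) =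
     Beta a m * integral {0<..<\<rho>} (\<lambda>t. of_real t powr (a + m - 1) * of_real (1 - t) powr (- m - 1))"
    using beta_fubini(2)[OF a m meas i1] i2 by (simp add: cut integral_beta_kernel a m)
  moreover have "integral {0<..} (\<lambda>u. of_real u powr (a - 1) * \<psi> u) =
     integral {0<..<\<rho>} (\<lambda>u. of_real u powr (a - 1) * of_real (\<rho> - u) powr m / of_real (1 - u)) *
        (of_real (1 - \<rho>) powr (- m) / m)"
  proof -
    have i: "{..<\<rho>} \<inter> {0<..} = {0<..<\<rho>}" by auto
    have "of_real u powr (a - 1) * \<psi> u = (if u \<in> {..<\<rho>} then
      (of_real u powr (a - 1) * of_real (\<rho> - u) powr m / of_real (1 - u)) *
        (of_real (1 - \<rho>) powr (- m) / m) else 0)" for u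
      using r cpowr_ratio[of "\<rho> - u" "1 - \<rho>" m] by (simp add: \<psi>_def mult_ac del: of_real_diff)
    then show ?thesis
      by (simp only: integral_restrict_Int i integral_mult_left)
  qed
  ultimately show ?thesis
    using m0 r by (simp add: powr_minus field_simps flip: of_real_diff)
qed

section \<open>Termwise integration, Abel's theorem and approximate identities\<close>

text \<open>
  Dominated convergence: on \<open>{0<..<y}\<close> all partial sums are bounded by the absolutely convergent
  series at \<open>y\<close>, so \<open>norm (W t)\<close> times a constant dominates.
\<close>
lemma has_integral_powser_weighted:
  fixes W :: "real \<Rightarrow> complex" and c w :: "nat \<Rightarrow> complex"
  assumes W: "W absolutely_integrable_on {0<..<y}" and \<nu>: "\<nu> > 0"
    and sm: "summable (\<lambda>n. norm (c n) * (y powr \<nu>) ^ n)"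
    and w: "\<And>n. integral {0<..<y} (\<lambda>t. W t * of_real (t powr \<nu>) ^ n) = w n"
  shows "(\<lambda>t. W t * (\<Sum>n. c n * of_real (t powr \<nu>) ^ n)) absolutely_integrable_on {0<..<y}"
    and "(\<lambda>n. c n * w n) sums integral {0<..<y} (\<lambda>t. W t * (\<Sum>n. c n * of_real (t powr \<nu>) ^ n))"
proof -
  define M where "M = (\<Sum>n. norm (c n) * (y powr \<nu>) ^ n)"
  define f where "f k t = W t * (\<Sum>n<k. c n * of_real (t powr \<nu>) ^ n)" for k t
  have nW: "(\<lambda>t. norm (W t)) integrable_on {0<..<y}"
    using W by (simp add: absolutely_integrable_on_def)
  have mW: "W \<in> borel_measurable (lebesgue_on {0<..<y})"
    using W by (intro absolutely_integrable_measurable[THEN iffD1, THEN conjunct1]) auto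
  have bound: "norm (c n * of_real (t powr \<nu>) ^ n) \<le> norm (c n) * (y powr \<nu>) ^ n"
    if "t \<in> {0<..<y}" for t n
    using that \<nu> by (auto simp: norm_mult norm_power intro!: mult_left_mono power_mono powr_mono2)
  have Wn: "(\<lambda>t. W t * of_real (t powr \<nu>) ^ n) absolutely_integrable_on {0<..<y}" for n
  proof (rule measurable_bounded_by_integrable_imp_absolutely_integrable)
    have "continuous_on {0<..<y} (\<lambda>t. complex_of_real (t powr \<nu>) ^ n)"
      by (intro continuous_intros) auto
    then have "(\<lambda>t. complex_of_real (t powr \<nu>) ^ n) \<in> borel_measurable (lebesgue_on {0<..<y})"
      by (rule continuous_imp_measurable_on_sets_lebesgue) auto
    then show "(\<lambda>t. W t * of_real (t powr \<nu>) ^ n) \<in> borel_measurable (lebesgue_on {0<..<y})"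
      using mW by (intro borel_measurable_times)
    show "(\<lambda>t. norm (W t) * (y powr \<nu>) ^ n) integrable_on {0<..<y}"
      by (intro integrable_on_mult_left nW)
    fix t assume "t \<in> {0<..<y}"
    then show "norm (W t * of_real (t powr \<nu>) ^ n) \<le> norm (W t) * (y powr \<nu>) ^ n"
      using \<nu> by (auto simp: norm_mult norm_power intro!: mult_left_mono power_mono powr_mono2)
  qed auto
  have f_eq: "f k t = (\<Sum>n<k. c n * (W t * of_real (t powr \<nu>) ^ n))" for k t
    by (simp add: f_def sum_distrib_left mult_ac)
  have fi: "(f k has_integral (\<Sum>n<k. c n * w n)) {0<..<y}" for k
    unfolding f_eq[abs_def]
  proof (intro has_integral_sum has_integral_mult_right)
    fix n
    show "((\<lambda>t. W t * of_real (t powr \<nu>) ^ n) has_integral w n) {0<..<y}"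
      using w[of n] set_lebesgue_integral_eq_integral(1)[OF Wn[of n]]
      by (auto simp: has_integral_iff)
  qed auto
  have h: "(\<lambda>t. norm (W t) * M) integrable_on {0<..<y}"
    by (intro integrable_on_mult_left nW)
  have le: "norm (f k t) \<le> norm (W t) * M" if t: "t \<in> {0<..<y}" for k t
  proof -
    have "norm (\<Sum>n<k. c n * of_real (t powr \<nu>) ^ n) \<le> (\<Sum>n<k. norm (c n) * (y powr \<nu>) ^ n)"
      by (intro sum_norm_le bound t)
    also have "\<dots> \<le> M" unfolding M_def by (intro sum_le_suminf sm) auto
    finally show ?thesis unfolding f_def norm_mult by (intro mult_left_mono) auto
  qed
  have lim: "(\<lambda>k. f k t) \<longlonglongrightarrow> W t * (\<Sum>n. c n * of_real (t powr \<nu>) ^ n)" if t: "t \<in> {0<..<y}" for t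
  proof -
    have "summable (\<lambda>n. c n * of_real (t powr \<nu>) ^ n)"
      using bound[OF t] by (intro summable_comparison_test'[OF sm]) auto
    then show ?thesis unfolding f_def by (intro tendsto_mult_left summable_LIMSEQ)
  qed
  have int: "(\<lambda>t. W t * (\<Sum>n. c n * of_real (t powr \<nu>) ^ n)) integrable_on {0<..<y}"
    by (rule dominated_convergence(1)[of f, OF _ h le lim]) (use fi in \<open>auto simp: integrable_on_def\<close>)
  show "(\<lambda>t. W t * (\<Sum>n. c n * of_real (t powr \<nu>) ^ n)) absolutely_integrable_on {0<..<y}"
  proof (rule absolutely_integrable_integrable_bound[OF _ int h])
    fix t assume t: "t \<in> {0<..<y}"
    show "norm (W t * (\<Sum>n. c n * of_real (t powr \<nu>) ^ n)) \<le> norm (W t) * M"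
      by (rule Lim_bounded[OF tendsto_norm[OF lim[OF t]], of 0]) (use le[OF t] in auto)
  qed
  have "(\<lambda>k. integral {0<..<y} (f k)) \<longlonglongrightarrow>
      integral {0<..<y} (\<lambda>t. W t * (\<Sum>n. c n * of_real (t powr \<nu>) ^ n))"
    by (rule dominated_convergence(2)[of f, OF _ h le lim]) (use fi in \<open>auto simp: integrable_on_def\<close>)
  then show "(\<lambda>n. c n * w n) sums integral {0<..<y} (\<lambda>t. W t * (\<Sum>n. c n * of_real (t powr \<nu>) ^ n))"
    unfolding sums_def integral_unique[OF fi] .
qed

text \<open>
  Abel's limit theorem. Summation by parts gives
  \<open>(\<Sum>n. a n * X ^ n) - suminf a = (1 - X) * (\<Sum>n. s n * X ^ n)\<close>, where \<open>s n\<close>, the error of the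
  \<open>n\<close>-th partial sum, tends to \<open>0\<close>.
\<close>
lemma Abel_limit:
  fixes a :: "nat \<Rightarrow> complex"
  assumes a: "summable a"
  shows "((\<lambda>X. \<Sum>n. a n * of_real X ^ n) \<longlongrightarrow> suminf a) (at_left 1)"
proof -
  define s where "s n = (\<Sum>k\<le>n. a k) - suminf a" for n
  have s0: "s \<longlonglongrightarrow> 0"
    unfolding s_def by (intro LIM_zero summable_LIMSEQ' a)
  then have "Bseq s" by (intro convergent_imp_Bseq convergentI)
  then obtain K where K: "K > 0" "\<And>n. norm (s n) \<le> K" by (auto elim: BseqE)
  have sm: "summable (\<lambda>n. norm (s n) * X ^ n)" if "0 \<le> X" "X < 1" for X :: real
    by (rule summable_comparison_test'[of "\<lambda>n. K * X ^ n" 0])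
      (use that K in \<open>auto intro!: summable_mult summable_geometric mult_right_mono simp: abs_mult\<close>)
  have sm': "summable (\<lambda>n. s n * of_real X ^ n)" if "0 \<le> X" "X < 1" for X :: real
    by (rule summable_norm_cancel) (use sm[OF that] that in \<open>simp add: norm_mult norm_power\<close>)
  have eq: "(\<Sum>n. a n * of_real X ^ n) - suminf a = (1 - of_real X) * (\<Sum>n. s n * of_real X ^ n)"
    if X: "0 \<le> X" "X < 1" for X :: real
  proof -
    let ?A = "\<Sum>n. s n * complex_of_real X ^ n"
    have 1: "(\<lambda>n. s n * of_real X ^ n) sums ?A" using sm'[OF X] by (rule summable_sums)
    then have 2: "(\<lambda>n. s (Suc n) * of_real X ^ Suc n) sums (?A - s 0)"
      using sums_Suc_iff[of "\<lambda>n. s n * complex_of_real X ^ n" "?A - s 0"] by simp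
    have "(\<lambda>n. s (Suc n) * of_real X ^ Suc n - of_real X * (s n * of_real X ^ n)) sums (?A - s 0 - of_real X * ?A)"
      by (intro sums_diff 2 sums_mult 1)
    moreover have "s (Suc n) * of_real X ^ Suc n - of_real X * (s n * of_real X ^ n) = a (Suc n) * of_real X ^ Suc n" for n
      by (simp add: s_def algebra_simps)
    ultimately have "(\<lambda>n. a (Suc n) * of_real X ^ Suc n) sums (?A - s 0 - of_real X * ?A)" by simp
    then have "(\<lambda>n. a n * of_real X ^ n) sums (?A - s 0 - of_real X * ?A + a 0)"
      using sums_Suc_iff[of "\<lambda>n. a n * complex_of_real X ^ n"] by simp
    then show ?thesis by (simp add: sums_iff s_def algebra_simps)
  qed
  have "((\<lambda>X. (\<Sum>n. a n * of_real X ^ n) - suminf a) \<longlongrightarrow> 0) (at_left 1)"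
  proof (rule tendstoI)
    fix e :: real assume e: "e > 0"
    obtain N where N: "\<And>n. n \<ge> N \<Longrightarrow> norm (s n) < e / 2"
      using LIMSEQ_D[OF s0, of "e / 2"] e by auto
    define B where "B = (\<Sum>n<N. norm (s n))"
    have "((\<lambda>X. (1 - X) * B) \<longlongrightarrow> (1 - 1) * B) (at_left (1::real))"
      by (intro tendsto_intros)
    then have "\<forall>\<^sub>F X in at_left (1::real). (1 - X) * B < e / 2"
      using e by (intro order_tendstoD(2)) auto
    moreover have "\<forall>\<^sub>F X in at_left (1::real). X \<in> {0<..<1}"
      by (intro eventually_at_leftI[of 0]) auto
    ultimately show "\<forall>\<^sub>F X in at_left (1::real). dist ((\<Sum>n. a n * of_real X ^ n) - suminf a) 0 < e"
    proof eventually_elim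
      case (elim X)
      then have X: "0 \<le> X" "X < 1" by auto
      have g: "(\<lambda>n. X ^ n) sums (1 / (1 - X))" using X by (intro geometric_sums) auto
      have t: "(\<lambda>n. if n < N then norm (s n) else 0) sums B"
        using sums_If_finite_set[of "{..<N}" "\<lambda>n. norm (s n)"] by (simp add: B_def)
      have "norm (\<Sum>n. s n * of_real X ^ n) \<le> (\<Sum>n. norm (s n) * X ^ n)"
        using sm[OF X] X summable_norm[of "\<lambda>n. s n * complex_of_real X ^ n"] by (simp add: norm_mult norm_power)
      also have "\<dots> \<le> (\<Sum>n. (if n < N then norm (s n) else 0) + e / 2 * X ^ n)"
      proof (rule suminf_le[OF _ sm[OF X]])
        fix n show "norm (s n) * X ^ n \<le> (if n < N then norm (s n) else 0) + e / 2 * X ^ n"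
        proof (cases "n < N")
          case True
          have "norm (s n) * X ^ n \<le> norm (s n) * 1"
            using X by (intro mult_left_mono power_le_one) auto
          then show ?thesis using True e X by (simp add: add_increasing2)
        next
          case False
          then show ?thesis using N[of n] X mult_right_mono[of "norm (s n)" "e / 2" "X ^ n"] by simp
        qed
      qed (intro summable_add summable_mult sums_summable[OF t] sums_summable[OF g])
      also have "\<dots> = B + e / 2 * (1 / (1 - X))"
        by (intro sums_unique[symmetric] sums_add t sums_mult g)
      finally have "(1 - X) * norm (\<Sum>n. s n * of_real X ^ n) \<le> (1 - X) * (B + e / 2 * (1 / (1 - X)))"
        using X by (intro mult_left_mono) auto
      also have "\<dots> = (1 - X) * B + e / 2" using X by (simp add: field_simps)
      also have "\<dots> < e" using elim by simp
      finally have "norm ((1 - complex_of_real X) * (\<Sum>n. s n * of_real X ^ n)) < e"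
        using X norm_of_real[of "1 - X", where 'a = complex] by (simp add: norm_mult)
      then show ?case by (simp add: eq[OF X])
    qed
  qed
  then show ?thesis by (rule LIM_zero_cancel)
qed

text \<open>
  Kernels of total mass near \<open>1\<close> and bounded absolute mass, which become uniformly small away
  from \<open>1\<close>, recover the left limit at \<open>1\<close>. Integrability of \<open>Y\<close> is asked for instead of
  boundedness, because \<open>Y\<close> is later a series with a factor \<open>t powr (l + m - 1)\<close>, which may be
  singular at \<open>0\<close>.
\<close>
lemma approximate_identity_at_left:
  fixes \<kappa> :: "real \<Rightarrow> real \<Rightarrow> complex" and Y :: "real \<Rightarrow> complex"
  assumes abs: "\<And>\<rho>. 0 < \<rho> \<Longrightarrow> \<rho> < 1 \<Longrightarrow> \<kappa> \<rho> absolutely_integrable_on {0<..<\<rho>}"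
    and C: "\<And>\<rho>. 0 < \<rho> \<Longrightarrow> \<rho> < 1 \<Longrightarrow> integral {0<..<\<rho>} (\<lambda>u. norm (\<kappa> \<rho> u)) \<le> C"
    and mass: "((\<lambda>\<rho>. integral {0<..<\<rho>} (\<kappa> \<rho>)) \<longlongrightarrow> 1) (at_left 1)"
    and small: "\<And>\<delta>. 0 < \<delta> \<Longrightarrow> \<delta> < 1 \<Longrightarrow> \<exists>c. (c \<longlongrightarrow> 0) (at_left 1) \<and>
        (\<forall>\<rho> u. 0 < u \<longrightarrow> u < \<delta> \<longrightarrow> \<delta> < \<rho> \<longrightarrow> \<rho> < 1 \<longrightarrow> norm (\<kappa> \<rho> u) \<le> c \<rho>)"
    and Yint: "\<And>\<delta>. 0 < \<delta> \<Longrightarrow> \<delta> < 1 \<Longrightarrow> Y absolutely_integrable_on {0<..<\<delta>}"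
    and Ylim: "(Y \<longlongrightarrow> y) (at_left 1)"
    and Yk: "\<And>\<rho>. 0 < \<rho> \<Longrightarrow> \<rho> < 1 \<Longrightarrow> (\<lambda>u. Y u * \<kappa> \<rho> u) integrable_on {0<..<\<rho>}"
  shows "((\<lambda>\<rho>. integral {0<..<\<rho>} (\<lambda>u. Y u * \<kappa> \<rho> u)) \<longlongrightarrow> y) (at_left 1)"
proof -
  have C0: "0 \<le> C"
    using C[of "1/2"] integral_nonneg[of "\<lambda>u. norm (\<kappa> (1/2) u)" "{0<..<1/2}"] abs[of "1/2"]
    by (auto simp: absolutely_integrable_on_def)
  have "((\<lambda>\<rho>. integral {0<..<\<rho>} (\<lambda>u. (Y u - y) * \<kappa> \<rho> u)) \<longlongrightarrow> 0) (at_left 1)"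
  proof (rule tendstoI)
    fix e :: real assume e: "e > 0"
    \<comment> \<open>the denominator is \<open>C + 1\<close> because \<open>C\<close> may be \<open>0\<close>\<close>
    define e' where "e' = e / (2 * (C + 1))"
    have e': "e' > 0" "e' * C \<le> e / 2" using e C0 by (auto simp: e'_def field_simps)
    from Ylim e'(1) have "\<forall>\<^sub>F u in at_left 1. dist (Y u) y < e'" by (rule tendstoD)
    then obtain d where d: "d < 1" "\<And>u. d < u \<Longrightarrow> u < 1 \<Longrightarrow> dist (Y u) y < e'"
      unfolding eventually_at_left_field by auto
    define \<delta> where "\<delta> = (1 + max d 0) / 2"
    have \<delta>: "0 < \<delta>" "\<delta> < 1" "d < \<delta>" using d(1) by (auto simp: \<delta>_def max_def)
    obtain c where c: "(c \<longlongrightarrow> 0) (at_left 1)"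
      "\<And>\<rho> u. 0 < u \<Longrightarrow> u < \<delta> \<Longrightarrow> \<delta> < \<rho> \<Longrightarrow> \<rho> < 1 \<Longrightarrow> norm (\<kappa> \<rho> u) \<le> c \<rho>"
      using small[OF \<delta>(1,2)] by blast
    have Yy: "(\<lambda>u. norm (Y u - y)) integrable_on {0<..<\<delta>}"
    proof -
      have "{0<..<\<delta>} \<in> lmeasurable" by (metis box_real(1) lmeasurable_box)
      then have "(\<lambda>u. Y u - y) absolutely_integrable_on {0<..<\<delta>}"
        by (intro set_integral_diff(1) Yint \<delta> absolutely_integrable_on_const)
      then show ?thesis by (simp add: absolutely_integrable_on_def)
    qed
    define B where "B = integral {0<..<\<delta>} (\<lambda>u. norm (Y u - y))"
    have "((\<lambda>\<rho>. c \<rho> * B) \<longlongrightarrow> 0 * B) (at_left 1)" by (intro tendsto_intros c)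
    then have "\<forall>\<^sub>F \<rho> in at_left 1. c \<rho> * B < e / 2"
      using e by (intro order_tendstoD(2)) auto
    moreover have "\<forall>\<^sub>F \<rho> in at_left (1::real). \<rho> \<in> {\<delta><..<1}"
      using \<delta> by (intro eventually_at_leftI[of \<delta>]) auto
    ultimately show "\<forall>\<^sub>F \<rho> in at_left 1. dist (integral {0<..<\<rho>} (\<lambda>u. (Y u - y) * \<kappa> \<rho> u)) 0 < e"
    proof eventually_elim
      case (elim \<rho>)
      then have r: "0 < \<rho>" "\<delta> < \<rho>" "\<rho> < 1" using \<delta> by auto
      define g where "g u = (if u \<in> {0<..<\<delta>} then c \<rho> * norm (Y u - y) else 0) + e' * norm (\<kappa> \<rho> u)" for u
      have i: "{0<..<\<delta>} \<inter> {0<..<\<rho>} = {0<..<\<delta>}" using r by auto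
      have "(\<lambda>u. if u \<in> {0<..<\<delta>} then c \<rho> * norm (Y u - y) else 0) integrable_on {0<..<\<rho>}"
        unfolding integrable_restrict_Int i by (intro integrable_on_mult_right Yy)
      then have g1: "((\<lambda>u. if u \<in> {0<..<\<delta>} then c \<rho> * norm (Y u - y) else 0) has_integral c \<rho> * B) {0<..<\<rho>}"
        unfolding has_integral_iff Henstock_Kurzweil_Integration.integral_restrict_Int i by (simp add: B_def)
      have g2: "((\<lambda>u. norm (\<kappa> \<rho> u)) has_integral integral {0<..<\<rho>} (\<lambda>u. norm (\<kappa> \<rho> u))) {0<..<\<rho>}"
        using abs[OF r(1,3)] by (simp add: absolutely_integrable_on_def integrable_integral)
      have g: "(g has_integral c \<rho> * B + e' * integral {0<..<\<rho>} (\<lambda>u. norm (\<kappa> \<rho> u))) {0<..<\<rho>}"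
        unfolding g_def by (intro has_integral_add g1 has_integral_mult_right g2)
      have "(\<lambda>u. (Y u - y) * \<kappa> \<rho> u) integrable_on {0<..<\<rho>}"
        unfolding left_diff_distrib using Yk[OF r(1,3)] abs[OF r(1,3)]
        by (intro integrable_diff integrable_on_mult_right) (auto simp: absolutely_integrable_on_def)
      moreover have "norm ((Y u - y) * \<kappa> \<rho> u) \<le> g u" if u: "u \<in> {0<..<\<rho>}" for u
      proof (cases "u < \<delta>")
        case True
        then have "norm (Y u - y) * norm (\<kappa> \<rho> u) \<le> norm (Y u - y) * c \<rho>"
          using u r c(2)[of u \<rho>] by (intro mult_left_mono) auto
        then show ?thesis using True u e'(1) by (simp add: g_def norm_mult mult_ac add_increasing2)
      next
        case False
        then have "norm (Y u - y) \<le> e'" using d(2)[of u] u r \<delta> by (auto simp: dist_norm)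
        then show ?thesis using False by (simp add: g_def norm_mult mult_right_mono)
      qed
      ultimately have "norm (integral {0<..<\<rho>} (\<lambda>u. (Y u - y) * \<kappa> \<rho> u)) \<le> integral {0<..<\<rho>} g"
        using g by (intro integral_norm_bound_integral) (auto simp: integrable_on_def)
      also have "\<dots> = c \<rho> * B + e' * integral {0<..<\<rho>} (\<lambda>u. norm (\<kappa> \<rho> u))"
        using g by (rule integral_unique)
      also have "\<dots> \<le> c \<rho> * B + e' * C"
        using C[OF r(1,3)] e' by (intro add_left_mono mult_left_mono) auto
      also have "\<dots> < e" using e'(2) elim by linarith
      finally show ?case by simp
    qed
  qed
  then have "((\<lambda>\<rho>. integral {0<..<\<rho>} (\<lambda>u. (Y u - y) * \<kappa> \<rho> u) + y * integral {0<..<\<rho>} (\<kappa> \<rho>)) \<longlongrightarrow> 0 + y * 1) (at_left 1)"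
    by (intro tendsto_intros mass)
  moreover have "\<forall>\<^sub>F \<rho> in at_left (1::real). \<rho> \<in> {0<..<1}"
    by (intro eventually_at_leftI[of 0]) auto
  then have "\<forall>\<^sub>F \<rho> in at_left (1::real). integral {0<..<\<rho>} (\<lambda>u. (Y u - y) * \<kappa> \<rho> u) + y * integral {0<..<\<rho>} (\<kappa> \<rho>)
     = integral {0<..<\<rho>} (\<lambda>u. Y u * \<kappa> \<rho> u)"
  proof eventually_elim
    case (elim \<rho>)
    then have "(\<lambda>u. y * \<kappa> \<rho> u) integrable_on {0<..<\<rho>}"
      using abs[of \<rho>] by (intro integrable_on_mult_right) (auto simp: absolutely_integrable_on_def)
    then show ?case using Yk[of \<rho>] elim by (simp add: left_diff_distrib integral_diff)
  qed
  ultimately show ?thesis using Lim_transform_eventually by fastforce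
qed

section \<open>Two kernels concentrating at one\<close>

text \<open>
  \<open>tail_kernel\<close> is the weight on the right of the smoothing identity; \<open>cut_kernel\<close> is minus the
  derivative of the cutoff \<open>((\<rho> - u) / (1 - u)) powr m\<close>. Both are \<open>X powr (m - 1) * X'\<close> up to a constant factor, for a
  Moebius map \<open>X\<close>, and both concentrate at \<open>1\<close> as \<open>\<rho>\<close> tends to \<open>1\<close>.
\<close>
definition tail_kernel :: "complex \<Rightarrow> real \<Rightarrow> real \<Rightarrow> complex" where
  "tail_kernel m \<rho> t = m * of_real (1 - \<rho>) powr m * of_real (1 - t) powr (- m - 1)"

definition cut_kernel :: "complex \<Rightarrow> real \<Rightarrow> real \<Rightarrow> complex" where
  "cut_kernel m \<rho> u =
     m * (of_real ((\<rho> - u) / (1 - u)) powr (m - 1) * of_real ((1 - \<rho>) / (1 - u)\<^sup>2))"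

lemma tendsto_one_minus_powr:
  assumes "Re m > 0"
  shows "((\<lambda>\<rho>. complex_of_real (1 - \<rho>) powr m) \<longlongrightarrow> 0) (at_left (1::real))"
proof -
  have "continuous_on {0..1} (\<lambda>\<rho>. complex_of_real (1 - \<rho>) powr m)"
    using assms by (intro continuous_on_cpowr_const continuous_intros) auto
  from this[unfolded continuous_on, rule_format, of 1]
  show ?thesis by (simp add: at_within_Icc_at_left)
qed

lemma tail_kernel_eq:
  assumes "0 < \<rho>" "\<rho> < 1" "t < 1"
  shows "tail_kernel m \<rho> t = m * (of_real ((1 - \<rho>) / (1 - t)) powr (m - 1) * of_real ((1 - \<rho>) / (1 - t)\<^sup>2))"
proof -
  have 1: "of_real ((1 - \<rho>) / (1 - t)) powr (m - 1) =
      complex_of_real (1 - \<rho>) powr (m - 1) * of_real (1 - t) powr (- (m - 1))"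
    using assms by (intro cpowr_ratio) auto
  have 2: "of_real ((1 - \<rho>) / (1 - t)\<^sup>2) = complex_of_real (1 - \<rho>) powr 1 * of_real (1 - t) powr (-2)"
    using assms by (simp add: powr_minus powr_numeral divide_inverse flip: of_real_diff)
  have 3: "complex_of_real (1 - \<rho>) powr m = complex_of_real (1 - \<rho>) powr (m - 1) * complex_of_real (1 - \<rho>) powr 1"
    by (simp only: powr_add[symmetric]) simp
  have "- m - 1 = - (m - 1) + (-2)" by simp
  then have 4: "complex_of_real (1 - t) powr (- m - 1) =
      complex_of_real (1 - t) powr (- (m - 1)) * of_real (1 - t) powr (-2)"
    by (simp only: powr_add)
  show ?thesis unfolding tail_kernel_def 1 2 3 4 by (simp only: mult_ac)
qed

lemma tail_kernel:
  assumes m: "Re m > 0" and r: "0 < \<rho>" "\<rho> < 1"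
  shows "tail_kernel m \<rho> absolutely_integrable_on {0<..<\<rho>}"
    and "integral {0<..<\<rho>} (tail_kernel m \<rho>) = 1 - of_real (1 - \<rho>) powr m"
    and "integral {0<..<\<rho>} (\<lambda>t. norm (tail_kernel m \<rho> t)) \<le> norm m / Re m"
proof -
  define X where "X t = (1 - \<rho>) / (1 - t)" for t
  define X' where "X' t = (1 - \<rho>) / (1 - t)\<^sup>2" for t
  have m0: "m \<noteq> 0" using m by auto
  have d: "(X has_real_derivative X' t) (at t)" if "t \<in> {0<..<\<rho>}" for t
    unfolding X_def X'_def using that r
    by (auto intro!: derivative_eq_intros simp: field_simps power2_eq_square)
  have c: "continuous_on {0..\<rho>} X" "continuous_on {0<..<\<rho>} X'"
    unfolding X_def X'_def using r by (auto intro!: continuous_intros)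
  have F1: "(\<lambda>t. of_real (X t) powr (m - 1) * of_real (X' t)) absolutely_integrable_on {0<..<\<rho>}"
    by (rule has_integral_cpowr_deriv[OF m less_imp_le[OF r(1)] c(1) _ _ d c(2), where s = 1])
      (use r in \<open>auto simp: X_def X'_def\<close>)
  have F2: "((\<lambda>t. of_real (X t) powr (m - 1) * of_real (X' t)) has_integral
            (of_real (X \<rho>) powr m - of_real (X 0) powr m) / m) {0<..<\<rho>}"
    by (rule has_integral_cpowr_deriv[OF m less_imp_le[OF r(1)] c(1) _ _ d c(2), where s = 1])
      (use r in \<open>auto simp: X_def X'_def\<close>)
  have F3: "((\<lambda>t. norm (of_real (X t) powr (m - 1) * complex_of_real (X' t))) has_integral
            1 * (X \<rho> powr Re m - X 0 powr Re m) / Re m) {0<..<\<rho>}"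
    by (rule has_integral_cpowr_deriv[OF m less_imp_le[OF r(1)] c(1) _ _ d c(2), where s = 1])
      (use r in \<open>auto simp: X_def X'_def\<close>)
  have e: "tail_kernel m \<rho> t = m * (of_real (X t) powr (m - 1) * complex_of_real (X' t))"
    if "t \<in> {0<..<\<rho>}" for t
    using tail_kernel_eq[of \<rho> t m] that r by (simp only: X_def X'_def) simp
  show "tail_kernel m \<rho> absolutely_integrable_on {0<..<\<rho>}"
    using F1 by (subst set_integrable_cong[OF refl refl e]) auto
  have "integral {0<..<\<rho>} (tail_kernel m \<rho>) =
      integral {0<..<\<rho>} (\<lambda>t. m * (of_real (X t) powr (m - 1) * complex_of_real (X' t)))"
    by (rule integral_cong) (rule e)
  also have "\<dots> = m * ((of_real (X \<rho>) powr m - of_real (X 0) powr m) / m)"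
    using has_integral_mult_right[OF F2] by (rule integral_unique)
  finally show "integral {0<..<\<rho>} (tail_kernel m \<rho>) = 1 - of_real (1 - \<rho>) powr m"
    using m0 r by (simp add: X_def)
  have "integral {0<..<\<rho>} (\<lambda>t. norm (tail_kernel m \<rho> t)) =
     integral {0<..<\<rho>} (\<lambda>t. norm m * norm (of_real (X t) powr (m - 1) * complex_of_real (X' t)))"
    by (rule integral_cong) (simp only: e norm_mult[of m])
  also have "\<dots> = norm m * (1 * (X \<rho> powr Re m - X 0 powr Re m) / Re m)"
    using has_integral_mult_right[OF F3] by (rule integral_unique)
  also have "\<dots> \<le> norm m * (1 / Re m)"
    using m r by (intro mult_left_mono divide_right_mono) (auto simp: X_def)
  finally show "integral {0<..<\<rho>} (\<lambda>t. norm (tail_kernel m \<rho> t)) \<le> norm m / Re m" by simp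
qed

lemma tail_kernel_small:
  assumes m: "Re m > 0" and d: "0 < \<delta>" "\<delta> < 1"
  shows "\<exists>c. (c \<longlongrightarrow> 0) (at_left 1) \<and>
        (\<forall>\<rho> u. 0 < u \<longrightarrow> u < \<delta> \<longrightarrow> \<delta> < \<rho> \<longrightarrow> \<rho> < 1 \<longrightarrow> norm (tail_kernel m \<rho> u) \<le> c \<rho>)"
proof (intro exI conjI allI impI)
  let ?c = "\<lambda>\<rho>. norm m * norm (complex_of_real (1 - \<rho>) powr m) * (1 - \<delta>) powr (- Re m - 1)"
  have "(?c \<longlongrightarrow> norm m * norm (0::complex) * (1 - \<delta>) powr (- Re m - 1)) (at_left 1)"
    using tendsto_one_minus_powr[OF m] by (intro tendsto_intros)
  then show "(?c \<longlongrightarrow> 0) (at_left 1)" by simp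
  fix \<rho> u :: real assume "0 < u" "u < \<delta>" "\<delta> < \<rho>" "\<rho> < 1"
  then show "norm (tail_kernel m \<rho> u) \<le> ?c \<rho>"
    unfolding tail_kernel_def norm_mult using norm_cpowr[of "1 - u" "- m - 1"] m d
    by (intro mult_left_mono) (auto intro!: powr_mono2' simp del: of_real_diff)
qed

lemma cut_kernel:
  assumes m: "Re m > 0" and r: "0 < \<rho>" "\<rho> < 1"
  shows "cut_kernel m \<rho> absolutely_integrable_on {0<..<\<rho>}"
    and "integral {0<..<\<rho>} (cut_kernel m \<rho>) = of_real \<rho> powr m"
    and "integral {0<..<\<rho>} (\<lambda>t. norm (cut_kernel m \<rho> t)) \<le> norm m / Re m"
    and "u \<in> {0<..<\<rho>} \<Longrightarrow>
      ((\<lambda>u. of_real ((\<rho> - u) / (1 - u)) powr m) has_vector_derivative - cut_kernel m \<rho> u) (at u)"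
proof -
  define X where "X t = (\<rho> - t) / (1 - t)" for t
  define X' where "X' t = - ((1 - \<rho>) / (1 - t)\<^sup>2)" for t
  have m0: "m \<noteq> 0" using m by auto
  have d: "(X has_real_derivative X' t) (at t)" if "t \<in> {0<..<\<rho>}" for t
    unfolding X_def X'_def using that r
    by (auto intro!: derivative_eq_intros simp: field_simps power2_eq_square)
      (simp add: diff_divide_distrib)
  have X': "\<bar>X' t\<bar> = -1 * X' t" for t
  proof -
    have "X' t \<le> 0" using r by (simp add: X'_def)
    then show ?thesis by simp
  qed
  have c: "continuous_on {0..\<rho>} X" "continuous_on {0<..<\<rho>} X'"
    unfolding X_def X'_def using r by (auto intro!: continuous_intros)
  have F1: "(\<lambda>t. of_real (X t) powr (m - 1) * of_real (X' t)) absolutely_integrable_on {0<..<\<rho>}"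
    by (rule has_integral_cpowr_deriv[OF m less_imp_le[OF r(1)] c(1) _ _ d c(2) X'])
      (use r in \<open>auto simp: X_def\<close>)
  have F2: "((\<lambda>t. of_real (X t) powr (m - 1) * of_real (X' t)) has_integral
            (of_real (X \<rho>) powr m - of_real (X 0) powr m) / m) {0<..<\<rho>}"
    by (rule has_integral_cpowr_deriv[OF m less_imp_le[OF r(1)] c(1) _ _ d c(2) X'])
      (use r in \<open>auto simp: X_def\<close>)
  have F3: "((\<lambda>t. norm (of_real (X t) powr (m - 1) * complex_of_real (X' t))) has_integral
            (-1) * (X \<rho> powr Re m - X 0 powr Re m) / Re m) {0<..<\<rho>}"
    by (rule has_integral_cpowr_deriv[OF m less_imp_le[OF r(1)] c(1) _ _ d c(2) X'])
      (use r in \<open>auto simp: X_def\<close>)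
  have e: "cut_kernel m \<rho> t = - m * (of_real (X t) powr (m - 1) * complex_of_real (X' t))" for t
    by (simp add: cut_kernel_def X_def X'_def)
  show "cut_kernel m \<rho> absolutely_integrable_on {0<..<\<rho>}"
    unfolding e[abs_def] using F1 by (intro set_integrable_mult_right)
  have "integral {0<..<\<rho>} (cut_kernel m \<rho>) = - m * ((of_real (X \<rho>) powr m - of_real (X 0) powr m) / m)"
    unfolding e[abs_def] using has_integral_mult_right[OF F2] by (rule integral_unique)
  then show "integral {0<..<\<rho>} (cut_kernel m \<rho>) = of_real \<rho> powr m"
    using m0 r by (simp add: X_def)
  have "integral {0<..<\<rho>} (\<lambda>t. norm (cut_kernel m \<rho> t)) =
      norm m * ((-1) * (X \<rho> powr Re m - X 0 powr Re m) / Re m)"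
    unfolding e norm_mult[of "- m"] norm_minus_cancel
    using has_integral_mult_right[OF F3] by (rule integral_unique)
  also have "\<dots> \<le> norm m * (1 / Re m)"
    using m r by (intro mult_left_mono divide_right_mono) (auto simp: X_def powr_le1)
  finally show "integral {0<..<\<rho>} (\<lambda>t. norm (cut_kernel m \<rho> t)) \<le> norm m / Re m" by simp
  assume u: "u \<in> {0<..<\<rho>}"
  then have "X u > 0" using r by (auto simp: X_def)
  from has_vector_derivative_cpowr[OF d[OF u] this, of m]
  show "((\<lambda>u. of_real ((\<rho> - u) / (1 - u)) powr m) has_vector_derivative - cut_kernel m \<rho> u) (at u)"
    unfolding e X_def by (simp only: mult_minus_left minus_minus mult.assoc)
qed

lemma cut_kernel_small:
  assumes d: "0 < \<delta>" "\<delta> < 1"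
  shows "\<exists>c. (c \<longlongrightarrow> 0) (at_left 1) \<and>
        (\<forall>\<rho> u. 0 < u \<longrightarrow> u < \<delta> \<longrightarrow> \<delta> < \<rho> \<longrightarrow> \<rho> < 1 \<longrightarrow> norm (cut_kernel m \<rho> u) \<le> c \<rho>)"
proof (intro exI conjI allI impI)
  let ?c = "\<lambda>\<rho>. norm m * ((1 + ((\<rho> - \<delta>) / (1 - \<delta>)) powr (Re m - 1)) * ((1 - \<rho>) / (1 - \<delta>)\<^sup>2))"
  have "(?c \<longlongrightarrow> norm m * ((1 + ((1 - \<delta>) / (1 - \<delta>)) powr (Re m - 1)) * ((1 - 1) / (1 - \<delta>)\<^sup>2))) (at_left 1)"
    using d by (intro tendsto_intros) auto
  then show "(?c \<longlongrightarrow> 0) (at_left 1)" by simp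
  fix \<rho> u :: real assume u: "0 < u" "u < \<delta>" "\<delta> < \<rho>" "\<rho> < 1"
  define x where "x = (\<rho> - u) / (1 - u)"
  have x: "0 < x" "x \<le> 1" "(\<rho> - \<delta>) / (1 - \<delta>) \<le> x" "0 < (\<rho> - \<delta>) / (1 - \<delta>)"
  proof -
    show "(\<rho> - \<delta>) / (1 - \<delta>) \<le> x"
      unfolding x_def using u mult_nonneg_nonneg[of "1 - \<rho>" "\<delta> - u"] by (simp add: divide_simps algebra_simps)
  qed (use u in \<open>auto simp: x_def\<close>)
  have n: "norm (cut_kernel m \<rho> u) = norm m * (x powr (Re m - 1) * ((1 - \<rho>) / (1 - u)\<^sup>2))"
    unfolding cut_kernel_def norm_mult x_def[symmetric] norm_of_real norm_cpowr[OF x(1)]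
    using u by simp
  \<comment> \<open>the first summand serves \<open>Re m \<ge> 1\<close>, the second \<open>Re m < 1\<close>\<close>
  have "x powr (Re m - 1) \<le> 1 + ((\<rho> - \<delta>) / (1 - \<delta>)) powr (Re m - 1)"
  proof (cases "Re m \<ge> 1")
    case True
    then have "x powr (Re m - 1) \<le> 1" using x by (intro powr_le1) auto
    then show ?thesis by (simp add: add_increasing2)
  next
    case False
    then have "x powr (Re m - 1) \<le> ((\<rho> - \<delta>) / (1 - \<delta>)) powr (Re m - 1)"
      using x by (intro powr_mono2') auto
    then show ?thesis by simp
  qed
  moreover have "(1 - \<rho>) / (1 - u)\<^sup>2 \<le> (1 - \<rho>) / (1 - \<delta>)\<^sup>2"
    using u by (intro divide_left_mono power_mono) auto
  ultimately show "norm (cut_kernel m \<rho> u) \<le> ?c \<rho>"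
    unfolding n using u by (intro mult_left_mono mult_mono) (auto intro!: add_nonneg_nonneg)
qed

section \<open>Termwise Beta transform of a power series\<close>

lemma cpowr_mult_power:
  assumes "t > 0"
  shows "complex_of_real t powr a * of_real (t powr \<nu>) ^ n = of_real t powr (a + of_real \<nu> * of_nat n)"
proof -
  have "complex_of_real (t powr \<nu>) ^ n = of_real t powr (of_real \<nu> * of_nat n)"
  proof -
    have "complex_of_real (t powr \<nu>) ^ n = of_real ((t powr \<nu>) powr real n)"
      using assms by (simp add: powr_realpow)
    also have "\<dots> = of_real (t powr (\<nu> * real n))" by (simp add: powr_powr)
    also have "\<dots> = of_real t powr of_real (\<nu> * real n)"
      using assms by (intro powr_of_real[symmetric]) auto
    finally show ?thesis by simp
  qed
  then show ?thesis by (simp add: powr_add)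
qed

text \<open>
  The hypothesis is stated on the open interval only, so a point \<open>z\<close> between \<open>y\<close> and \<open>b\<close> supplies
  the larger radius at which the power series converges.
\<close>
lemma powser_in_powr_has_vector_derivative:
  fixes c :: "nat \<Rightarrow> complex"
  assumes sm: "\<And>y. 0 < y \<Longrightarrow> y < b \<Longrightarrow> summable (\<lambda>n. norm (c n) * (y powr \<nu>) ^ n)"
    and \<nu>: "\<nu> > 0" and y: "0 < y" "y < b"
  shows "((\<lambda>y. \<Sum>n. c n * of_real (y powr \<nu>) ^ n) has_vector_derivative
     (\<Sum>n. of_nat n * c n * of_real (y powr \<nu>) ^ n) * of_real (\<nu> / y)) (at y)"
    and "summable (\<lambda>n. norm (of_nat n * c n) * (y powr \<nu>) ^ n)"
proof -
  obtain z where z: "y < z" "z < b" using y dense by blast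
  let ?X = "complex_of_real (y powr \<nu>)" and ?Z = "complex_of_real (z powr \<nu>)"
  have X0: "?X \<noteq> 0" using y by simp
  have lt: "norm ?X < norm ?Z" using y z \<nu> by (simp add: powr_less_mono2)
  have "summable (\<lambda>n. norm (c n * ?Z ^ n))"
    using sm[of z] y z by (simp add: norm_mult norm_power)
  then have sZ: "summable (\<lambda>n. c n * ?Z ^ n)" by (rule summable_norm_cancel)
  have D: "((\<lambda>X. \<Sum>n. c n * X ^ n) has_field_derivative (\<Sum>n. diffs c n * ?X ^ n)) (at ?X)"
    by (rule termdiffs_strong[OF sZ lt])
  have sZr: "summable (\<lambda>n. norm (c n) * x ^ n)" if "norm x < z powr \<nu>" for x :: real
    using powser_insidea[OF sZ, of "of_real x"] that
    by (intro summable_norm_cancel[of "\<lambda>n. norm (c n) * x ^ n"]) (simp add: norm_mult norm_power abs_mult power_abs)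
  have sdr: "summable (\<lambda>n. diffs (\<lambda>n. norm (c n)) n * (y powr \<nu>) ^ n)"
    by (rule termdiff_converges[of _ "z powr \<nu>"]) (use lt sZr in auto)
  have "(\<lambda>n. of_nat n * norm (c n) * (y powr \<nu>) ^ (n - Suc 0)) sums
      (\<Sum>n. diffs (\<lambda>n. norm (c n)) n * (y powr \<nu>) ^ n)"
    by (rule diffs_equiv[OF sdr])
  then have "summable (\<lambda>n. (y powr \<nu>) * (of_nat n * norm (c n) * (y powr \<nu>) ^ (n - Suc 0)))"
    by (intro summable_mult sums_summable)
  moreover have "(y powr \<nu>) * (of_nat n * norm (c n) * (y powr \<nu>) ^ (n - Suc 0)) =
     norm (of_nat n * c n) * (y powr \<nu>) ^ n" for n
    by (cases n) (simp_all add: norm_mult del: of_nat_Suc)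
  ultimately show "summable (\<lambda>n. norm (of_nat n * c n) * (y powr \<nu>) ^ n)" by simp
  have sd: "summable (\<lambda>n. diffs c n * ?X ^ n)"
    by (rule termdiff_converges[of _ "norm ?Z"]) (use lt sZ powser_inside in blast)+
  have "(\<lambda>n. of_nat n * c n * ?X ^ (n - Suc 0)) sums (\<Sum>n. diffs c n * ?X ^ n)"
    by (rule diffs_equiv[OF sd])
  then have "(\<lambda>n. (of_nat n * c n * ?X ^ (n - Suc 0)) * ?X) sums ((\<Sum>n. diffs c n * ?X ^ n) * ?X)"
    by (rule sums_mult2)
  moreover have "(of_nat n * c n * ?X ^ (n - Suc 0)) * ?X = of_nat n * c n * ?X ^ n" for n
    by (cases n) simp_all
  ultimately have e: "(\<Sum>n. diffs c n * ?X ^ n) * ?X = (\<Sum>n. of_nat n * c n * ?X ^ n)"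
    by (simp add: sums_iff)
  have "((\<lambda>y. y powr \<nu>) has_real_derivative \<nu> * y powr (\<nu> - 1)) (at y)"
    using y by (auto intro!: derivative_eq_intros)
  then have "((\<lambda>y. complex_of_real (y powr \<nu>)) has_vector_derivative of_real (\<nu> * y powr (\<nu> - 1))) (at y)"
    by (intro has_vector_derivative_of_real) (simp add: has_real_derivative_iff_has_vector_derivative)
  from field_vector_diff_chain_at[OF this D]
  have "((\<lambda>y. \<Sum>n. c n * of_real (y powr \<nu>) ^ n) has_vector_derivative
      of_real (\<nu> * y powr (\<nu> - 1)) * (\<Sum>n. diffs c n * ?X ^ n)) (at y)"
    by (simp only: o_def)
  also have "of_real (\<nu> * y powr (\<nu> - 1)) * (\<Sum>n. diffs c n * ?X ^ n) =
     (\<Sum>n. of_nat n * c n * ?X ^ n) * of_real (\<nu> / y)"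
    unfolding e[symmetric] using y by (simp add: powr_diff)
  finally show "((\<lambda>y. \<Sum>n. c n * of_real (y powr \<nu>) ^ n) has_vector_derivative
     (\<Sum>n. of_nat n * c n * of_real (y powr \<nu>) ^ n) * of_real (\<nu> / y)) (at y)" .
qed

text \<open>
  The smoothing identity, summed over the exponents \<open>l + \<nu> * n\<close>. The cut at \<open>\<rho> < 1\<close> keeps both
  series inside their region of absolute convergence, so both sides may be integrated termwise.
\<close>
lemma beta_smoothing_powser:
  fixes b :: "nat \<Rightarrow> complex" and l m :: complex and \<nu> :: real
  defines "B \<equiv> \<lambda>n. Beta (l + of_real \<nu> * of_nat n) m"
  assumes l: "Re l > 0" and m: "Re m > 0" and \<nu>: "\<nu> > 0" and r: "0 < \<rho>" "\<rho> < 1"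
    and sb: "\<And>z. 0 < z \<Longrightarrow> z < 1 \<Longrightarrow> summable (\<lambda>n. norm (b n) * (z powr \<nu>) ^ n)"
    and sB: "\<And>z. 0 < z \<Longrightarrow> z < 1 \<Longrightarrow> summable (\<lambda>n. norm (b n * B n) * (z powr \<nu>) ^ n)"
  defines "F \<equiv> \<lambda>t. of_real t powr (l + m - 1) * (\<Sum>n. (b n * B n) * of_real (t powr \<nu>) ^ n)"
  shows "(\<lambda>t. F t * tail_kernel m \<rho> t) integrable_on {0<..<\<rho>}"
    and "integral {0<..<\<rho>} (\<lambda>u. of_real u powr (l - 1) * of_real (\<rho> - u) powr m / of_real (1 - u) *
           (\<Sum>n. b n * of_real (u powr \<nu>) ^ n)) =
         integral {0<..<\<rho>} (\<lambda>t. F t * tail_kernel m \<rho> t)"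
    and "F absolutely_integrable_on {0<..<\<rho>}"
proof -
  define W1 where "W1 u = of_real u powr (l - 1) * of_real (\<rho> - u) powr m / of_real (1 - u)" for u
  define W2 where "W2 t = of_real t powr (l + m - 1) * tail_kernel m \<rho> t" for t
  define w where "w n = integral {0<..<\<rho>} (\<lambda>t. W2 t * of_real (t powr \<nu>) ^ n)" for n
  have lm: "Re (l + m) > 0" using l m by simp
  have i0: "(\<lambda>u. u powr (Re l - 1)) integrable_on {0<..<\<rho>}"
    using l r integrable_on_powr_from_0[of "Re l - 1" \<rho>] by (simp add: integrable_on_Icc_iff_Ioo)
  have W1: "W1 absolutely_integrable_on {0<..<\<rho>}"
  proof -
    have "continuous_on {0..\<rho>} (\<lambda>u. complex_of_real (\<rho> - u) powr m / of_real (1 - u))"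
      using r m by (intro continuous_intros continuous_on_cpowr_const) auto
    then have "bounded ((\<lambda>u. complex_of_real (\<rho> - u) powr m / of_real (1 - u)) ` {0..\<rho>})"
      by (intro compact_imp_bounded compact_continuous_image) auto
    then obtain K where K: "\<And>t. t \<in> {0..\<rho>} \<Longrightarrow> norm (complex_of_real (\<rho> - t) powr m / of_real (1 - t)) \<le> K"
      unfolding bounded_iff by blast
    show ?thesis
    proof (rule continuous_bounded_imp_absolutely_integrable)
      show "continuous_on {0<..<\<rho>} W1"
        unfolding W1_def using r m
        by (intro continuous_intros continuous_on_cpowr_const) (auto simp: complex_nonpos_Reals_iff)
      show "(\<lambda>u. u powr (Re l - 1) * K) integrable_on {0<..<\<rho>}"
        by (intro integrable_on_mult_left i0)
      fix u assume u: "u \<in> {0<..<\<rho>}"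
      then show "norm (W1 u) \<le> u powr (Re l - 1) * K"
        unfolding W1_def times_divide_eq_right[symmetric] norm_mult
        using norm_cpowr[of u "l - 1"] K[of u] by (intro mult_mono) auto
    qed auto
  qed
  have W2: "W2 absolutely_integrable_on {0<..<\<rho>}"
  proof -
    have "(\<lambda>t. (m * of_real (1 - \<rho>) powr m) * (of_real t powr (l + m - 1) * complex_of_real (1 - t) powr (- m - 1)))
      absolutely_integrable_on {0<..<\<rho>}"
      by (intro set_integrable_mult_right smoothing_kernel_absolutely_integrable lm r)
    then show ?thesis unfolding W2_def tail_kernel_def by (simp only: mult_ac)
  qed
  have W1n: "integral {0<..<\<rho>} (\<lambda>u. W1 u * of_real (u powr \<nu>) ^ n) = B n * w n" for n
  proof -
    let ?a = "l + of_real \<nu> * of_nat n"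
    have a: "Re ?a > 0" using l \<nu> by (simp add: add_pos_nonneg)
    have "integral {0<..<\<rho>} (\<lambda>u. W1 u * of_real (u powr \<nu>) ^ n) =
      integral {0<..<\<rho>} (\<lambda>u. of_real u powr (?a - 1) * of_real (\<rho> - u) powr m / of_real (1 - u))"
    proof (rule integral_cong)
      fix u assume "u \<in> {0<..<\<rho>}"
      then have "of_real u powr (?a - 1) = of_real u powr (l - 1) * complex_of_real (u powr \<nu>) ^ n"
        using cpowr_mult_power[of u "l - 1" \<nu> n] by (simp add: algebra_simps)
      then show "W1 u * of_real (u powr \<nu>) ^ n =
          of_real u powr (?a - 1) * of_real (\<rho> - u) powr m / of_real (1 - u)"
        by (simp add: W1_def)
    qed
    also have "\<dots> = m * of_real (1 - \<rho>) powr m * B n *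
       integral {0<..<\<rho>} (\<lambda>t. of_real t powr (?a + m - 1) * of_real (1 - t) powr (- m - 1))"
      unfolding B_def by (rule beta_smoothing[OF a m r])
    also have "\<dots> = B n * integral {0<..<\<rho>} (\<lambda>t. m * of_real (1 - \<rho>) powr m *
         (of_real t powr (?a + m - 1) * of_real (1 - t) powr (- m - 1)))"
      by simp
    also have "integral {0<..<\<rho>} (\<lambda>t. m * of_real (1 - \<rho>) powr m *
         (of_real t powr (?a + m - 1) * of_real (1 - t) powr (- m - 1))) = w n"
      unfolding w_def
    proof (rule integral_cong)
      fix t assume "t \<in> {0<..<\<rho>}"
      then have "of_real t powr (?a + m - 1) = of_real t powr (l + m - 1) * complex_of_real (t powr \<nu>) ^ n"
        using cpowr_mult_power[of t "l + m - 1" \<nu> n] by (simp add: algebra_simps)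
      then show "m * of_real (1 - \<rho>) powr m * (of_real t powr (?a + m - 1) * of_real (1 - t) powr (- m - 1)) =
          W2 t * of_real (t powr \<nu>) ^ n"
        by (simp add: W2_def tail_kernel_def)
    qed
    finally show ?thesis .
  qed
  note T1 = has_integral_powser_weighted[OF W1 \<nu> sb[OF r] W1n]
  note T2 = has_integral_powser_weighted[OF W2 \<nu> sB[OF r] w_def[symmetric]]
  have F2: "W2 t * (\<Sum>n. (b n * B n) * of_real (t powr \<nu>) ^ n) = F t * tail_kernel m \<rho> t" for t
    by (simp add: W2_def F_def)
  show "(\<lambda>t. F t * tail_kernel m \<rho> t) integrable_on {0<..<\<rho>}"
    using T2(1) unfolding F2 by (rule set_lebesgue_integral_eq_integral(1))
  have "integral {0<..<\<rho>} (\<lambda>u. W1 u * (\<Sum>n. b n * of_real (u powr \<nu>) ^ n)) = (\<Sum>n. b n * (B n * w n))"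
    using T1(2) by (rule sums_unique)
  also have "\<dots> = (\<Sum>n. b n * B n * w n)" by (simp add: mult.assoc)
  also have "\<dots> = integral {0<..<\<rho>} (\<lambda>t. F t * tail_kernel m \<rho> t)"
    using T2(2) unfolding F2 by (rule sums_unique[symmetric])
  finally show "integral {0<..<\<rho>} (\<lambda>u. of_real u powr (l - 1) * of_real (\<rho> - u) powr m / of_real (1 - u) *
           (\<Sum>n. b n * of_real (u powr \<nu>) ^ n)) =
         integral {0<..<\<rho>} (\<lambda>t. F t * tail_kernel m \<rho> t)"
    by (simp only: W1_def)
  have "(\<lambda>t. of_real t powr (l + m - 1) * complex_of_real (1 - t) powr 0) absolutely_integrable_on {0<..<\<rho>}"
    by (intro smoothing_kernel_absolutely_integrable lm r)
  then have W3: "(\<lambda>t. complex_of_real t powr (l + m - 1)) absolutely_integrable_on {0<..<\<rho>}"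
    by (rule set_integrable_cong[OF refl refl, THEN iffD1, rotated]) (use r in auto)
  show "F absolutely_integrable_on {0<..<\<rho>}"
    unfolding F_def by (rule has_integral_powser_weighted(1)[OF W3 \<nu> sB[OF r] refl])
qed

text \<open>
  For a merely Henstock-Kurzweil integrable \<open>h\<close> dominated convergence is unavailable. Integration by
  parts moves the cutoff onto the continuous indefinite integral \<open>H\<close> of \<open>h\<close>, which is then averaged
  against the concentrating \<open>cut_kernel\<close>.
\<close>
lemma tendsto_integral_cut:
  fixes h :: "real \<Rightarrow> complex"
  assumes m: "Re m > 0" and h: "h integrable_on {0..1}"
    and c: "continuous_on {0<..<1} h"
  shows "((\<lambda>\<rho>. integral {0<..<\<rho>} (\<lambda>u. h u * of_real ((\<rho> - u) / (1 - u)) powr m))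
           \<longlongrightarrow> integral {0..1} h) (at_left 1)"
proof -
  define H where "H u = integral {0..u} h" for u
  have cH: "continuous_on {0..1} H"
    unfolding H_def using h by (rule indefinite_integral_continuous_1)
  have Hlim: "(H \<longlongrightarrow> integral {0..1} h) (at_left 1)"
    using cH[unfolded continuous_on, rule_format, of 1] by (simp add: at_within_Icc_at_left H_def)
  have HD: "(H has_vector_derivative h u) (at u)" if u: "u \<in> {0<..<1}" for u
  proof -
    \<comment> \<open>continuity makes the indefinite integral differentiable at every interior point\<close>
    have "isCont h u" using c u by (simp add: continuous_on_eq_continuous_at)
    then have "continuous (at u within {0..1}) h" by (rule continuous_at_imp_continuous_at_within)
    then have "(H has_vector_derivative h u) (at u within {0..1})"
      unfolding H_def using integral_has_vector_derivative_continuous_at[OF h, of u "{}"] u by auto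
    moreover have "at u within {0..1} = at u" using u by (intro at_within_interior) auto
    ultimately show ?thesis by simp
  qed
  have Hk: "(\<lambda>u. H u * cut_kernel m \<rho> u) absolutely_integrable_on {0<..<\<rho>}" if r: "0 < \<rho>" "\<rho> < 1" for \<rho>
  proof -
    have "bounded (H ` {0..1})" by (intro compact_imp_bounded compact_continuous_image cH) auto
    then obtain K where K: "\<And>u. u \<in> {0..1} \<Longrightarrow> norm (H u) \<le> K" unfolding bounded_iff by blast
    have cc: "continuous_on {0<..<\<rho>} (\<lambda>u. H u * cut_kernel m \<rho> u)"
      unfolding cut_kernel_def using r
      by (intro continuous_intros continuous_on_subset[OF cH]) (auto simp: complex_nonpos_Reals_iff)
    have ii: "(\<lambda>u. K * norm (cut_kernel m \<rho> u)) integrable_on {0<..<\<rho>}"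
      using cut_kernel(1)[OF m r] by (intro integrable_on_mult_right) (simp add: absolutely_integrable_on_def)
    show ?thesis
      by (rule continuous_bounded_imp_absolutely_integrable[OF cc _ ii])
        (use r K in \<open>auto simp: norm_mult intro!: mult_right_mono\<close>)
  qed
  have "((\<lambda>\<rho>. integral {0<..<\<rho>} (\<lambda>u. H u * cut_kernel m \<rho> u)) \<longlongrightarrow> integral {0..1} h) (at_left 1)"
  proof (rule approximate_identity_at_left)
    show "H absolutely_integrable_on {0<..<\<delta>}" if "0 < \<delta>" "\<delta> < 1" for \<delta>
    proof -
      have "H absolutely_integrable_on {0..\<delta>}"
        using that by (intro absolutely_integrable_continuous_real continuous_on_subset[OF cH]) auto
      then show ?thesis by (rule set_integrable_subset) auto
    qed
    have "((\<lambda>\<rho>. complex_of_real \<rho> powr m) \<longlongrightarrow> of_real 1 powr m) (at_left 1)"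
      by (intro tendsto_intros) auto
    then have "((\<lambda>\<rho>. complex_of_real \<rho> powr m) \<longlongrightarrow> 1) (at_left 1)" by simp
    moreover have "\<forall>\<^sub>F \<rho> in at_left (1::real). \<rho> \<in> {0<..<1}"
      by (intro eventually_at_leftI[of 0]) auto
    then have "\<forall>\<^sub>F \<rho> in at_left 1. complex_of_real \<rho> powr m = integral {0<..<\<rho>} (cut_kernel m \<rho>)"
      by eventually_elim (simp add: cut_kernel(2)[OF m])
    ultimately show "((\<lambda>\<rho>. integral {0<..<\<rho>} (cut_kernel m \<rho>)) \<longlongrightarrow> 1) (at_left 1)"
      by (rule Lim_transform_eventually)
  qed (use cut_kernel[OF m] cut_kernel_small Hlim Hk in \<open>auto intro: set_lebesgue_integral_eq_integral(1)\<close>)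
  moreover have "\<forall>\<^sub>F \<rho> in at_left (1::real). \<rho> \<in> {0<..<1}"
    by (intro eventually_at_leftI[of 0]) auto
  then have "\<forall>\<^sub>F \<rho> in at_left 1. integral {0<..<\<rho>} (\<lambda>u. H u * cut_kernel m \<rho> u) =
      integral {0<..<\<rho>} (\<lambda>u. h u * of_real ((\<rho> - u) / (1 - u)) powr m)"
  proof eventually_elim
    case (elim \<rho>)
    then have r: "0 < \<rho>" "\<rho> < 1" by auto
    let ?k = "\<lambda>u. complex_of_real ((\<rho> - u) / (1 - u)) powr m"
    define y where "y = integral {0<..<\<rho>} (\<lambda>u. H u * cut_kernel m \<rho> u)"
    have m0: "m \<noteq> 0" using m by auto
    have "((\<lambda>u. H u * cut_kernel m \<rho> u) has_integral y) {0<..<\<rho>}"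
      unfolding y_def using set_lebesgue_integral_eq_integral(1)[OF Hk[OF r]] by (rule integrable_integral)
    from has_integral_neg[OF this]
    \<comment> \<open>the boundary terms vanish: the cutoff is \<open>0\<close> at \<open>\<rho>\<close>, and \<open>H\<close> is \<open>0\<close> at \<open>0\<close>\<close>
    have "((\<lambda>u. H u * (- cut_kernel m \<rho> u)) has_integral (H \<rho> * ?k \<rho> - H 0 * ?k 0 - y)) {0..\<rho>}"
      using m0 r by (simp add: has_integral_Icc_iff_Ioo H_def)
    then have "((\<lambda>u. h u * ?k u) has_integral y) {0..\<rho>}"
      using r m HD cut_kernel(4)[OF m r]
      by (intro integration_by_parts_interior[OF bounded_bilinear_mult, of 0 \<rho> H ?k h "\<lambda>u. - cut_kernel m \<rho> u"]
            continuous_on_subset[OF cH] continuous_on_cpowr_const continuous_intros) auto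
    then show ?case by (simp add: has_integral_Icc_iff_Ioo y_def integral_unique)
  qed
  ultimately show ?thesis by (rule Lim_transform_eventually)
qed

text \<open>
  Termwise integration of a Beta integral under two assumptions that are both only conditional: the
  series of the integrals converges, and the integral of the series exists. The truncated integrals
  with the cutoff \<open>((\<rho> - u) / (1 - u)) powr m\<close> converge to the integral by
  \<open>tendsto_integral_cut\<close>; by the smoothing identity they are averages of the Abel means \<open>F\<close> of the
  series, and hence converge to its sum.
\<close>
lemma integral_beta_powser:
  fixes b :: "nat \<Rightarrow> complex" and l m :: complex and \<nu> :: real
  defines "B \<equiv> \<lambda>n. Beta (l + of_real \<nu> * of_nat n) m"
    and "g \<equiv> \<lambda>z. \<Sum>n. b n * of_real (z powr \<nu>) ^ n"
  assumes l: "Re l > 0" and m: "Re m > 0" and \<nu>: "\<nu> > 0"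
    and sb: "\<And>z. 0 < z \<Longrightarrow> z < 1 \<Longrightarrow> summable (\<lambda>n. norm (b n) * (z powr \<nu>) ^ n)"
    and bB: "summable (\<lambda>n. b n * B n)"
    and int: "beta_integrand g l m integrable_on {0<..<1}"
  shows "integral {0<..<1} (beta_integrand g l m) = (\<Sum>n. b n * B n)"
proof -
  define h where "h = beta_integrand g l m"
  define F where "F t = of_real t powr (l + m - 1) * (\<Sum>n. (b n * B n) * of_real (t powr \<nu>) ^ n)" for t
  have h: "h integrable_on {0..1}"
    unfolding h_def using int by (simp add: integrable_on_Icc_iff_Ioo)
  have sB: "summable (\<lambda>n. norm (b n * B n) * (z powr \<nu>) ^ n)" if z: "0 < z" "z < 1" for z
  proof -
    have "z powr \<nu> < 1 powr \<nu>" using z \<nu> by (intro powr_less_mono2) auto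
    then have "norm (complex_of_real (z powr \<nu>)) < norm (1 :: complex)" by simp
    from powser_insidea[OF _ this, of "\<lambda>n. b n * B n"] bB show ?thesis
      by (simp add: norm_mult norm_power)
  qed
  have c: "continuous_on {0<..<1} h"
  proof -
    have "continuous_on {0<..<1} g"
      unfolding continuous_on_eq_continuous_within
    proof
      fix u :: real assume "u \<in> {0<..<1}"
      then have "isCont g u"
        unfolding g_def
        using has_vector_derivative_continuous[OF powser_in_powr_has_vector_derivative(1)[OF sb \<nu>, where b = 1 and y = u]]
        by simp
      then show "continuous (at u within {0<..<1}) g" by (rule continuous_at_imp_continuous_at_within)
    qed
    then show ?thesis unfolding h_def beta_integrand_def
      by (intro continuous_intros) (auto simp: complex_nonpos_Reals_iff)
  qed
  have in01: "\<forall>\<^sub>F \<rho> in at_left (1::real). \<rho> \<in> {0<..<1}"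
    by (intro eventually_at_leftI[of 0]) auto
  have Flim: "(F \<longlongrightarrow> (\<Sum>n. b n * B n)) (at_left 1)"
  proof -
    have "filterlim (\<lambda>t::real. t powr \<nu>) (at_left 1) (at_left 1)"
    proof (rule filterlim_at_withinI)
      have "((\<lambda>t::real. t powr \<nu>) \<longlongrightarrow> 1 powr \<nu>) (at_left 1)"
        by (intro tendsto_intros) auto
      then show "((\<lambda>t::real. t powr \<nu>) \<longlongrightarrow> 1) (at_left 1)" by simp
      show "\<forall>\<^sub>F t in at_left (1::real). t powr \<nu> \<in> {..<1} - {1}"
        using in01
      proof eventually_elim
        case (elim t)
        then have "t powr \<nu> < 1 powr \<nu>" using \<nu> by (intro powr_less_mono2) auto
        then show ?case by simp
      qed
    qed
    from filterlim_compose[OF Abel_limit[OF bB] this]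
    have "((\<lambda>t. \<Sum>n. b n * B n * of_real (t powr \<nu>) ^ n) \<longlongrightarrow> (\<Sum>n. b n * B n)) (at_left 1)" .
    moreover have "((\<lambda>t. complex_of_real t powr (l + m - 1)) \<longlongrightarrow> of_real 1 powr (l + m - 1)) (at_left 1)"
      by (intro tendsto_intros) auto
    ultimately have "(F \<longlongrightarrow> of_real 1 powr (l + m - 1) * (\<Sum>n. b n * B n)) (at_left 1)"
      unfolding F_def by (intro tendsto_mult)
    then show ?thesis by simp
  qed
  have S: "(\<lambda>t. F t * tail_kernel m \<rho> t) integrable_on {0<..<\<rho>}"
    "integral {0<..<\<rho>} (\<lambda>u. of_real u powr (l - 1) * of_real (\<rho> - u) powr m / of_real (1 - u) * g u) =
       integral {0<..<\<rho>} (\<lambda>t. F t * tail_kernel m \<rho> t)"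
    "F absolutely_integrable_on {0<..<\<rho>}" if r: "0 < \<rho>" "\<rho> < 1" for \<rho>
    using beta_smoothing_powser[OF l m \<nu> r sb sB[unfolded B_def]]
    by (simp_all only: F_def[abs_def] B_def g_def)
  have "((\<lambda>\<rho>. integral {0<..<\<rho>} (\<lambda>t. F t * tail_kernel m \<rho> t)) \<longlongrightarrow> (\<Sum>n. b n * B n)) (at_left 1)"
  proof (rule approximate_identity_at_left)
    have "((\<lambda>\<rho>. 1 - complex_of_real (1 - \<rho>) powr m) \<longlongrightarrow> 1 - 0) (at_left 1)"
      by (intro tendsto_intros tendsto_one_minus_powr m)
    then have "((\<lambda>\<rho>. 1 - complex_of_real (1 - \<rho>) powr m) \<longlongrightarrow> 1) (at_left 1)" by simp
    moreover have "\<forall>\<^sub>F \<rho> in at_left 1. 1 - complex_of_real (1 - \<rho>) powr m = integral {0<..<\<rho>} (tail_kernel m \<rho>)"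
      using in01 by eventually_elim (use tail_kernel(2)[OF m] in auto)
    ultimately show "((\<lambda>\<rho>. integral {0<..<\<rho>} (tail_kernel m \<rho>)) \<longlongrightarrow> 1) (at_left 1)"
      by (rule Lim_transform_eventually)
  qed (use tail_kernel[OF m] tail_kernel_small[OF m] Flim S in auto)
  moreover have "\<forall>\<^sub>F \<rho> in at_left 1. integral {0<..<\<rho>} (\<lambda>t. F t * tail_kernel m \<rho> t) =
      integral {0<..<\<rho>} (\<lambda>u. h u * of_real ((\<rho> - u) / (1 - u)) powr m)"
    using in01
  proof eventually_elim
    case (elim \<rho>)
    then have r: "0 < \<rho>" "\<rho> < 1" by auto
    have "integral {0<..<\<rho>} (\<lambda>u. h u * of_real ((\<rho> - u) / (1 - u)) powr m) =
       integral {0<..<\<rho>} (\<lambda>u. of_real u powr (l - 1) * of_real (\<rho> - u) powr m / of_real (1 - u) * g u)"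
    proof (rule integral_cong)
      fix u assume u: "u \<in> {0<..<\<rho>}"
      have "complex_of_real (1 - u) powr (m - 1) * of_real (1 - u) powr (- m) = of_real (1 - u) powr (- 1)"
        by (simp only: powr_add[symmetric]) simp
      also have "\<dots> = 1 / of_real (1 - u)"
        using u r by (simp add: powr_minus divide_inverse flip: of_real_diff)
      finally have "complex_of_real (1 - u) powr (m - 1) * of_real ((\<rho> - u) / (1 - u)) powr m
          = of_real (\<rho> - u) powr m / of_real (1 - u)"
        using cpowr_ratio[of "\<rho> - u" "1 - u" m] u r by (simp only: greaterThanLessThan_iff) (simp add: mult_ac del: of_real_diff)
      then show "h u * of_real ((\<rho> - u) / (1 - u)) powr m =
          of_real u powr (l - 1) * of_real (\<rho> - u) powr m / of_real (1 - u) * g u"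
        unfolding h_def beta_integrand_def by (simp only: mult_ac times_divide_eq_right times_divide_eq_left)
    qed
    also have "\<dots> = integral {0<..<\<rho>} (\<lambda>t. F t * tail_kernel m \<rho> t)"
      by (rule S(2)[OF r])
    finally show ?case by simp
  qed
  ultimately have "((\<lambda>\<rho>. integral {0<..<\<rho>} (\<lambda>u. h u * of_real ((\<rho> - u) / (1 - u)) powr m)) \<longlongrightarrow> (\<Sum>n. b n * B n)) (at_left 1)"
    by (rule Lim_transform_eventually)
  from tendsto_unique[OF _ tendsto_integral_cut[OF m h c] this]
  show ?thesis by (simp add: h_def integral_open_interval_real trivial_limit_at_left_real)
qed

section \<open>Fractional derivative of a power series\<close>

lemma cpowr_of_powr:
  assumes "t > 0"
  shows "complex_of_real (t powr \<eta>) powr c = of_real t powr (of_real \<eta> * c)"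
  using assms by (simp add: powr_def[where 'a = complex] Ln_of_real ln_powr mult_ac)

text \<open>
  The substitution \<open>v = t powr \<eta>\<close> turns the kernel of the generalized fractional integral into a
  Beta kernel on \<open>{0<..<y powr \<eta>}\<close>.
\<close>
lemma erdelyi_kober_kernel:
  fixes \<alpha> \<tau> :: complex
  assumes \<eta>: "\<eta> > 0" and \<alpha>: "Re \<alpha> > 0" and \<tau>: "Re \<tau> > 0" and y: "y > 0"
  defines "W \<equiv> \<lambda>t. of_real (t powr (\<eta> - 1)) * of_real t powr \<alpha> * of_real (y powr \<eta> - t powr \<eta>) powr (\<tau> - 1)"
  shows "W absolutely_integrable_on {0<..<y}"
    and "integral {0<..<y} W = of_real y powr (\<alpha> + of_real \<eta> * \<tau>) * Beta (\<alpha> / of_real \<eta> + 1) \<tau> / of_real \<eta>"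
proof -
  define a where "a = \<alpha> / of_real \<eta> + 1"
  have a: "Re a > 0" using \<alpha> \<eta> by (simp add: a_def add_pos_pos)
  have im: "(\<lambda>t. t powr \<eta>) ` {0<..<y} = {0<..<y powr \<eta>}"
  proof (intro equalityI subsetI)
    fix v assume v: "v \<in> {0<..<y powr \<eta>}"
    have "v powr (1 / \<eta>) < (y powr \<eta>) powr (1 / \<eta>)"
      using v \<eta> by (intro powr_less_mono2) auto
    then show "v \<in> (\<lambda>t. t powr \<eta>) ` {0<..<y}"
      using v \<eta> y by (intro image_eqI[of _ _ "v powr (1 / \<eta>)"]) (auto simp: powr_powr)
  qed (use \<eta> y in \<open>auto intro!: powr_less_mono2\<close>)
  have inj: "inj_on (\<lambda>t. t powr \<eta>) {0<..<y}"
    using \<eta> powr_less_mono2[of \<eta>]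
    by (intro inj_onI) (metis greaterThanLessThan_iff less_imp_le less_irrefl linorder_less_linear)
  have e: "\<bar>\<eta> * t powr (\<eta> - 1)\<bar> *\<^sub>R beta_kernel a \<tau> (y powr \<eta>) (t powr \<eta>) = of_real \<eta> * W t"
    if t: "t \<in> {0<..<y}" for t
  proof -
    have "complex_of_real (t powr \<eta>) powr (a - 1) = of_real t powr \<alpha>"
      using t \<eta> by (simp add: cpowr_of_powr a_def)
    then show ?thesis using \<eta> t
      by (simp add: beta_kernel_def W_def scaleR_conv_of_real abs_mult del: of_real_diff)
  qed
  have pw: "complex_of_real (y powr \<eta>) powr (a + \<tau> - 1) = of_real y powr (\<alpha> + of_real \<eta> * \<tau>)"
    using y \<eta> by (simp add: cpowr_of_powr a_def algebra_simps)
  have yy: "y powr \<eta> > 0" using y by simp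
  have "beta_kernel a \<tau> (y powr \<eta>) absolutely_integrable_on (\<lambda>t. t powr \<eta>) ` {0<..<y} \<and>
     integral ((\<lambda>t. t powr \<eta>) ` {0<..<y}) (beta_kernel a \<tau> (y powr \<eta>)) =
       of_real y powr (\<alpha> + of_real \<eta> * \<tau>) * Beta a \<tau>"
    unfolding im using beta_kernel_scale(1)[OF a \<tau> yy] beta_kernel_integral[OF a \<tau> yy] pw by simp
  then have *: "(\<lambda>t. \<bar>\<eta> * t powr (\<eta> - 1)\<bar> *\<^sub>R beta_kernel a \<tau> (y powr \<eta>) (t powr \<eta>)) absolutely_integrable_on {0<..<y} \<and>
     integral {0<..<y} (\<lambda>t. \<bar>\<eta> * t powr (\<eta> - 1)\<bar> *\<^sub>R beta_kernel a \<tau> (y powr \<eta>) (t powr \<eta>)) =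
       of_real y powr (\<alpha> + of_real \<eta> * \<tau>) * Beta a \<tau>"
    by (subst has_absolute_integral_change_of_variables_real)
      (use inj in \<open>auto intro!: derivative_eq_intros\<close>)
  have "(\<lambda>t. of_real \<eta> * W t) absolutely_integrable_on {0<..<y}"
    using *[THEN conjunct1] by (subst (asm) set_integrable_cong[OF refl refl e])
  then have "(\<lambda>t. (1 / of_real \<eta>) * (of_real \<eta> * W t)) absolutely_integrable_on {0<..<y}"
    by (rule set_integrable_mult_right)
  then show "W absolutely_integrable_on {0<..<y}" using \<eta> by simp
  have "integral {0<..<y} (\<lambda>t. \<bar>\<eta> * t powr (\<eta> - 1)\<bar> *\<^sub>R beta_kernel a \<tau> (y powr \<eta>) (t powr \<eta>)) =
      integral {0<..<y} (\<lambda>t. of_real \<eta> * W t)"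
    by (rule integral_cong) (rule e)
  then have "of_real \<eta> * integral {0<..<y} W = of_real y powr (\<alpha> + of_real \<eta> * \<tau>) * Beta a \<tau>"
    using * by simp
  then show "integral {0<..<y} W = of_real y powr (\<alpha> + of_real \<eta> * \<tau>) * Beta (\<alpha> / of_real \<eta> + 1) \<tau> / of_real \<eta>"
    using \<eta> by (simp add: a_def field_simps)
qed

text \<open>
  For fixed \<open>b\<close> the Beta integrand decreases in modulus when the first argument grows. Hence the
  Beta factors created by fractional integration are bounded in \<open>n\<close> and do not affect convergence.
\<close>
lemma norm_Beta_le:
  assumes "Re a > 0" "Re b > 0" "x \<ge> 0"
  shows "norm (Beta (a + of_real x) b) \<le> integral {0<..<1} (\<lambda>u. norm (beta_kernel a b 1 u))"
proof -
  have a': "Re (a + of_real x) > 0" using assms by simp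
  have "norm (integral {0<..<1} (beta_kernel (a + of_real x) b 1)) \<le> integral {0<..<1} (\<lambda>u. norm (beta_kernel a b 1 u))"
  proof (rule integral_norm_bound_integral)
    show "beta_kernel (a + of_real x) b 1 integrable_on {0<..<1}"
      using beta_kernel_absolutely_integrable_1[OF a' assms(2)] by (simp add: absolutely_integrable_on_def)
    show "(\<lambda>u. norm (beta_kernel a b 1 u)) integrable_on {0<..<1}"
      using beta_kernel_absolutely_integrable_1[OF assms(1,2)] by (simp add: absolutely_integrable_on_def)
    fix u :: real assume "u \<in> {0<..<1}"
    then show "norm (beta_kernel (a + of_real x) b 1 u) \<le> norm (beta_kernel a b 1 u)"
      using assms by (auto simp: norm_beta_kernel intro!: mult_right_mono powr_mono')
  qed
  then show ?thesis using a' assms by (simp add: integral_beta_kernel)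
qed

lemma frac_order_greater: "Re \<sigma> > 0 \<Longrightarrow> Re (of_nat (frac_order \<sigma>) - \<sigma>) > 0"
  unfolding frac_order_def by simp linarith

lemma frac_integral_powser:
  fixes a :: "nat \<Rightarrow> complex" and \<sigma> \<mu> :: complex and \<eta> \<nu> :: real
  defines "\<tau> \<equiv> of_nat (frac_order \<sigma>) - \<sigma>"
  defines "e \<equiv> \<lambda>n. a n * Beta (\<mu> / of_real \<eta> + 1 + of_real (\<nu> / \<eta>) * of_nat n) \<tau> / of_real \<eta>"
  assumes \<eta>: "\<eta> > 0" and \<nu>: "\<nu> > 0" and \<sigma>: "Re \<sigma> > 0" and \<mu>: "Re \<mu> > 0"
    and f: "\<And>t. 0 < t \<Longrightarrow> f t = of_real t powr \<mu> * (\<Sum>n. a n * of_real (t powr \<nu>) ^ n)"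
    and y: "0 < y" and sm: "summable (\<lambda>n. norm (a n) * (y powr \<nu>) ^ n)"
  shows "frac_integral \<eta> \<sigma> f y = of_real y powr (\<mu> + of_real \<eta> * \<tau>) * (\<Sum>n. e n * of_real (y powr \<nu>) ^ n)"
    and "summable (\<lambda>n. norm (e n) * (y powr \<nu>) ^ n)"
proof -
  have \<tau>: "Re \<tau> > 0" unfolding \<tau>_def using \<sigma> by (rule frac_order_greater)
  define W where "W t = of_real (t powr (\<eta> - 1)) * of_real t powr \<mu> * of_real (y powr \<eta> - t powr \<eta>) powr (\<tau> - 1)" for t
  have W: "W absolutely_integrable_on {0<..<y}"
    unfolding W_def by (rule erdelyi_kober_kernel(1)[OF \<eta> \<mu> \<tau> y])
  have c0: "complex_of_real y powr (\<mu> + of_real \<eta> * \<tau>) \<noteq> 0" using y by simp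
  have w: "integral {0<..<y} (\<lambda>t. W t * of_real (t powr \<nu>) ^ n) =
      of_real y powr (\<mu> + of_real \<eta> * \<tau>) * of_real (y powr \<nu>) ^ n *
        Beta (\<mu> / of_real \<eta> + 1 + of_real (\<nu> / \<eta>) * of_nat n) \<tau> / of_real \<eta>" for n
  proof -
    let ?\<alpha> = "\<mu> + of_real \<nu> * of_nat n"
    have \<alpha>: "Re ?\<alpha> > 0" using \<mu> \<nu> by (simp add: add_pos_nonneg)
    have "integral {0<..<y} (\<lambda>t. W t * of_real (t powr \<nu>) ^ n) =
      integral {0<..<y} (\<lambda>t. of_real (t powr (\<eta> - 1)) * of_real t powr ?\<alpha> * of_real (y powr \<eta> - t powr \<eta>) powr (\<tau> - 1))"
      by (rule integral_cong) (simp add: W_def cpowr_mult_power[symmetric])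
    also have "\<dots> = of_real y powr (?\<alpha> + of_real \<eta> * \<tau>) * Beta (?\<alpha> / of_real \<eta> + 1) \<tau> / of_real \<eta>"
      by (rule erdelyi_kober_kernel(2)[OF \<eta> \<alpha> \<tau> y])
    also have "?\<alpha> / of_real \<eta> + 1 = \<mu> / of_real \<eta> + 1 + of_real (\<nu> / \<eta>) * of_nat n"
      by (simp add: add_divide_distrib)
    also have "complex_of_real y powr (?\<alpha> + of_real \<eta> * \<tau>) = of_real y powr (\<mu> + of_real \<eta> * \<tau>) * of_real (y powr \<nu>) ^ n"
      using y by (simp add: cpowr_mult_power add_ac)
    finally show ?thesis .
  qed
  note T = has_integral_powser_weighted(2)[OF W \<nu> sm w]
  have e: "a n * (of_real y powr (\<mu> + of_real \<eta> * \<tau>) * of_real (y powr \<nu>) ^ n *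
        Beta (\<mu> / of_real \<eta> + 1 + of_real (\<nu> / \<eta>) * of_nat n) \<tau> / of_real \<eta>) =
     of_real y powr (\<mu> + of_real \<eta> * \<tau>) * (e n * of_real (y powr \<nu>) ^ n)" for n
    by (simp add: e_def)
  have "frac_integral \<eta> \<sigma> f y = integral {0<..<y} (\<lambda>t. W t * (\<Sum>n. a n * of_real (t powr \<nu>) ^ n))"
    unfolding frac_integral_def
  proof (rule integral_cong)
    fix t assume t: "t \<in> {0<..<y}"
    have "\<sigma> - of_nat (frac_order \<sigma>) + 1 = - (\<tau> - 1)" by (simp add: \<tau>_def)
    then have "x / z powr (\<sigma> - of_nat (frac_order \<sigma>) + 1) = x * z powr (\<tau> - 1)" for x z :: complex
      by (simp only: powr_minus divide_inverse inverse_inverse_eq)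
    then show "frac_integrand \<eta> \<sigma> f y t = W t * (\<Sum>n. a n * of_real (t powr \<nu>) ^ n)"
      using t by (simp add: frac_integrand_def f W_def mult_ac)
  qed
  also have "\<dots> = (\<Sum>n. of_real y powr (\<mu> + of_real \<eta> * \<tau>) * (e n * of_real (y powr \<nu>) ^ n))"
    using T unfolding e by (rule sums_unique)
  also have "\<dots> = of_real y powr (\<mu> + of_real \<eta> * \<tau>) * (\<Sum>n. e n * of_real (y powr \<nu>) ^ n)"
  proof (rule suminf_mult)
    have "summable (\<lambda>n. of_real y powr (\<mu> + of_real \<eta> * \<tau>) * (e n * of_real (y powr \<nu>) ^ n))"
      using T unfolding e by (rule sums_summable)
    then show "summable (\<lambda>n. e n * of_real (y powr \<nu>) ^ n)"
      using c0 by (simp only: summable_cmult_iff) simp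
  qed
  finally show "frac_integral \<eta> \<sigma> f y = of_real y powr (\<mu> + of_real \<eta> * \<tau>) * (\<Sum>n. e n * of_real (y powr \<nu>) ^ n)" .
  define K where "K = integral {0<..<1} (\<lambda>u. norm (beta_kernel (\<mu> / of_real \<eta> + 1) \<tau> 1 u))"
  have p: "Re (\<mu> / of_real \<eta> + 1) > 0" using \<mu> \<eta> by (simp add: add_pos_pos)
  show "summable (\<lambda>n. norm (e n) * (y powr \<nu>) ^ n)"
  proof (rule summable_comparison_test'[of "\<lambda>n. K / \<eta> * (norm (a n) * (y powr \<nu>) ^ n)" 0])
    show "summable (\<lambda>n. K / \<eta> * (norm (a n) * (y powr \<nu>) ^ n))" by (intro summable_mult sm)
    fix n :: nat
    have "norm (Beta (\<mu> / of_real \<eta> + 1 + of_real (\<nu> / \<eta> * real n)) \<tau>) \<le> K"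
      unfolding K_def using p \<tau> \<eta> \<nu> by (intro norm_Beta_le) auto
    then have "norm (e n) \<le> norm (a n) * K / \<eta>"
      using \<eta> by (simp add: e_def norm_mult norm_divide divide_right_mono mult_left_mono)
    then have "norm (e n) * (y powr \<nu>) ^ n \<le> (norm (a n) * K / \<eta>) * (y powr \<nu>) ^ n"
      by (intro mult_right_mono) auto
    then show "norm (norm (e n) * (y powr \<nu>) ^ n) \<le> K / \<eta> * (norm (a n) * (y powr \<nu>) ^ n)"
      by (simp add: mult_ac)
  qed
qed

text \<open>
  One application of the operator lowers the exponent by \<open>\<eta>\<close> and multiplies the \<open>n\<close>-th coefficient
  by the exponent that it carried. The coefficients enter through this recursion, so that an explicit
  solution can be supplied afterwards.
\<close>
lemma weighted_deriv_powser_iterate: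
  fixes e :: "nat \<Rightarrow> nat \<Rightarrow> complex" and \<beta> :: complex
  assumes \<nu>: "\<nu> > 0"
    and I: "\<And>y. 0 < y \<Longrightarrow> y < b \<Longrightarrow> I y = of_real y powr \<beta> * (\<Sum>n. e 0 n * of_real (y powr \<nu>) ^ n)"
    and sm: "\<And>y. 0 < y \<Longrightarrow> y < b \<Longrightarrow> summable (\<lambda>n. norm (e 0 n) * (y powr \<nu>) ^ n)"
    and e: "\<And>j n. e (Suc j) n = (\<beta> - of_real \<eta> * of_nat j + of_real \<nu> * of_nat n) * e j n"
    and y: "0 < y" "y < b"
  shows "(weighted_deriv \<eta> ^^ j) I y = of_real y powr (\<beta> - of_real \<eta> * of_nat j) * (\<Sum>n. e j n * of_real (y powr \<nu>) ^ n)"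
    and "summable (\<lambda>n. norm (e j n) * (y powr \<nu>) ^ n)"
proof -
  have "\<forall>y. 0 < y \<longrightarrow> y < b \<longrightarrow>
     (weighted_deriv \<eta> ^^ j) I y = of_real y powr (\<beta> - of_real \<eta> * of_nat j) * (\<Sum>n. e j n * of_real (y powr \<nu>) ^ n) \<and>
     summable (\<lambda>n. norm (e j n) * (y powr \<nu>) ^ n)"
  proof (induction j)
    case 0
    then show ?case using I sm by simp
  next
    case (Suc j)
    define \<gamma> where "\<gamma> = \<beta> - of_real \<eta> * of_nat j"
    define S where "S y = (\<Sum>n. e j n * of_real (y powr \<nu>) ^ n)" for y
    define S' where "S' y = (\<Sum>n. of_nat n * e j n * of_real (y powr \<nu>) ^ n)" for y
    have sj: "\<And>y. 0 < y \<Longrightarrow> y < b \<Longrightarrow> summable (\<lambda>n. norm (e j n) * (y powr \<nu>) ^ n)"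
      using Suc.IH by blast
    show ?case
    proof (intro allI impI)
      fix y assume y: "0 < y" "y < b"
      have sc: "summable (\<lambda>n. c n * of_real (y powr \<nu>) ^ n)"
        if "summable (\<lambda>n. norm (c n) * (y powr \<nu>) ^ n)" for c :: "nat \<Rightarrow> complex"
        using that by (intro summable_norm_cancel[of "\<lambda>n. c n * of_real (y powr \<nu>) ^ n"])
          (simp add: norm_mult norm_power)
      note D = powser_in_powr_has_vector_derivative[OF sj \<nu> y]
      have e': "e (Suc j) n = \<gamma> * e j n + of_real \<nu> * (of_nat n * e j n)" for n
        by (simp add: e \<gamma>_def algebra_simps)
      have "(S has_vector_derivative S' y * of_real (\<nu> / y)) (at y)"
        unfolding S_def S'_def by (rule D(1))
      moreover have "((\<lambda>y. complex_of_real y powr \<gamma>) has_vector_derivative \<gamma> * of_real y powr (\<gamma> - 1)) (at y)"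
        using has_vector_derivative_cpowr[of "\<lambda>y. y" 1 y \<gamma>] y by simp
      ultimately have "((\<lambda>y. of_real y powr \<gamma> * S y) has_vector_derivative
          of_real y powr \<gamma> * (S' y * of_real (\<nu> / y)) + \<gamma> * of_real y powr (\<gamma> - 1) * S y) (at y)"
        by (intro has_vector_derivative_mult)
      then have "((weighted_deriv \<eta> ^^ j) I has_vector_derivative
          of_real y powr \<gamma> * (S' y * of_real (\<nu> / y)) + \<gamma> * of_real y powr (\<gamma> - 1) * S y) (at y)"
        by (rule has_vector_derivative_transform_within_open[of _ _ _ "{0<..<b}"])
          (use y Suc.IH in \<open>auto simp: \<gamma>_def S_def\<close>)
      then have "(weighted_deriv \<eta> ^^ Suc j) I y = of_real (y powr (1 - \<eta>)) *
          (of_real y powr \<gamma> * (S' y * of_real (\<nu> / y)) + \<gamma> * of_real y powr (\<gamma> - 1) * S y)"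
        by (simp add: weighted_deriv_def vector_derivative_at)
      also have "of_real y powr \<gamma> * (S' y * of_real (\<nu> / y)) + \<gamma> * of_real y powr (\<gamma> - 1) * S y =
          of_real y powr (\<gamma> - 1) * (\<gamma> * S y + of_real \<nu> * S' y)"
      proof -
        have "complex_of_real y powr \<gamma> = of_real y powr (\<gamma> - 1) * of_real y"
          using y by (simp add: powr_diff)
        then show ?thesis using y by (simp add: field_simps)
      qed
      also have "\<gamma> * S y + of_real \<nu> * S' y = (\<Sum>n. e (Suc j) n * of_real (y powr \<nu>) ^ n)"
        unfolding S_def S'_def e' distrib_right mult.assoc
        using sc[OF sj[OF y]] sc[OF D(2)]
        by (subst suminf_add[symmetric]) (simp_all add: suminf_mult summable_mult mult.assoc)
      also have "of_real (y powr (1 - \<eta>)) * (of_real y powr (\<gamma> - 1) * X) =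
          of_real y powr (\<beta> - of_real \<eta> * of_nat (Suc j)) * X" for X :: complex
      proof -
        have "complex_of_real (y powr (1 - \<eta>)) = of_real y powr (of_real (1 - \<eta>))"
          using y by (intro powr_of_real[symmetric]) auto
        then have "complex_of_real (y powr (1 - \<eta>)) * of_real y powr (\<gamma> - 1) =
           of_real y powr (of_real (1 - \<eta>) + (\<gamma> - 1))"
          by (simp only: powr_add)
        also have "of_real (1 - \<eta>) + (\<gamma> - 1) = \<beta> - of_real \<eta> * of_nat (Suc j)"
          by (simp add: \<gamma>_def algebra_simps)
        finally show ?thesis by (simp only: mult.assoc[symmetric])
      qed
      finally have 1: "(weighted_deriv \<eta> ^^ Suc j) I y =
         of_real y powr (\<beta> - of_real \<eta> * of_nat (Suc j)) * (\<Sum>n. e (Suc j) n * of_real (y powr \<nu>) ^ n)" .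
      have "summable (\<lambda>n. norm (e (Suc j) n) * (y powr \<nu>) ^ n)"
      proof (rule summable_comparison_test'[of "\<lambda>n. norm \<gamma> * (norm (e j n) * (y powr \<nu>) ^ n)
            + \<nu> * (norm (of_nat n * e j n) * (y powr \<nu>) ^ n)" 0])
        show "summable (\<lambda>n. norm \<gamma> * (norm (e j n) * (y powr \<nu>) ^ n)
            + \<nu> * (norm (of_nat n * e j n) * (y powr \<nu>) ^ n))"
          by (intro summable_add summable_mult sj y D(2))
        fix n :: nat
        have "norm (e (Suc j) n) \<le> norm \<gamma> * norm (e j n) + \<nu> * norm (of_nat n * e j n)"
          unfolding e' using norm_triangle_ineq[of "\<gamma> * e j n" "of_real \<nu> * (of_nat n * e j n)"] \<nu>
          by (simp add: norm_mult)
        then have "norm (e (Suc j) n) * (y powr \<nu>) ^ n \<le>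
            (norm \<gamma> * norm (e j n) + \<nu> * norm (of_nat n * e j n)) * (y powr \<nu>) ^ n"
          by (intro mult_right_mono) auto
        then show "norm (norm (e (Suc j) n) * (y powr \<nu>) ^ n) \<le> norm \<gamma> * (norm (e j n) * (y powr \<nu>) ^ n)
            + \<nu> * (norm (of_nat n * e j n) * (y powr \<nu>) ^ n)"
          by (simp add: algebra_simps)
      qed
      with 1 show "(weighted_deriv \<eta> ^^ Suc j) I y =
          of_real y powr (\<beta> - of_real \<eta> * of_nat (Suc j)) * (\<Sum>n. e (Suc j) n * of_real (y powr \<nu>) ^ n) \<and>
          summable (\<lambda>n. norm (e (Suc j) n) * (y powr \<nu>) ^ n)" by blast
    qed
  qed
  then show "(weighted_deriv \<eta> ^^ j) I y = of_real y powr (\<beta> - of_real \<eta> * of_nat j) * (\<Sum>n. e j n * of_real (y powr \<nu>) ^ n)"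
    and "summable (\<lambda>n. norm (e j n) * (y powr \<nu>) ^ n)" using y by blast+
qed

text \<open>
  Fractional integration gives the coefficients \<open>e 0\<close>; the recursion of the iterated derivative is
  solved by \<open>e j\<close> through \<open>z * rGamma (z + 1) = rGamma z\<close>. As this identity holds for all \<open>z\<close>, the
  case where \<open>p n - \<sigma>\<close> is a pole of \<open>Gamma\<close> and the term vanishes is covered as well.
\<close>
lemma frac_deriv_powser:
  fixes a :: "nat \<Rightarrow> complex" and \<sigma> \<mu> :: complex and \<eta> \<nu> :: real
  defines "p \<equiv> \<lambda>n. \<mu> / of_real \<eta> + 1 + of_real (\<nu> / \<eta>) * of_nat n"
  assumes \<eta>: "\<eta> > 0" and \<nu>: "\<nu> > 0" and \<sigma>: "Re \<sigma> > 0" and \<mu>: "Re \<mu> > 0"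
    and f: "\<And>t. 0 < t \<Longrightarrow> f t = of_real t powr \<mu> * (\<Sum>n. a n * of_real (t powr \<nu>) ^ n)"
    and sm: "\<And>y. 0 < y \<Longrightarrow> y < b \<Longrightarrow> summable (\<lambda>n. norm (a n) * (y powr \<nu>) ^ n)"
    and x: "0 < x" "x < b"
  shows "frac_deriv \<eta> \<sigma> f x = of_real \<eta> powr \<sigma> * of_real x powr (\<mu> - \<sigma> * of_real \<eta>) *
           (\<Sum>n. a n * (Gamma (p n) * rGamma (p n - \<sigma>)) * of_real (x powr \<nu>) ^ n)"
    and "summable (\<lambda>n. norm (a n * (Gamma (p n) * rGamma (p n - \<sigma>))) * (x powr \<nu>) ^ n)"
proof -
  define N where "N = frac_order \<sigma>"
  define \<tau> where "\<tau> = of_nat N - \<sigma>"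
  define \<beta> where "\<beta> = \<mu> + of_real \<eta> * \<tau>"
  define e where "e j n = a n * (of_real \<eta> ^ j / of_real \<eta> * Gamma \<tau> * Gamma (p n) * rGamma (p n + \<tau> - of_nat j))" for j n
  have \<tau>: "Re \<tau> > 0" unfolding \<tau>_def N_def using \<sigma> by (rule frac_order_greater)
  then have G0: "Gamma \<tau> \<noteq> 0" using Re_pos_not_nonpos_Ints by (simp add: Gamma_eq_zero_iff)
  have \<eta>0: "complex_of_real \<eta> \<noteq> 0" using \<eta> by simp
  have e0: "e 0 n = a n * Beta (\<mu> / of_real \<eta> + 1 + of_real (\<nu> / \<eta>) * of_nat n) (of_nat (frac_order \<sigma>) - \<sigma>) / of_real \<eta>" for n
    by (simp add: e_def Beta_altdef p_def \<tau>_def N_def)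
  have I: "frac_integral \<eta> \<sigma> f y = of_real y powr \<beta> * (\<Sum>n. e 0 n * of_real (y powr \<nu>) ^ n)"
    "summable (\<lambda>n. norm (e 0 n) * (y powr \<nu>) ^ n)" if "0 < y" "y < b" for y
    using frac_integral_powser[OF \<eta> \<nu> \<sigma> \<mu> f that(1) sm[OF that]]
    unfolding e0 \<beta>_def \<tau>_def N_def by auto
  have eS: "e (Suc j) n = (\<beta> - of_real \<eta> * of_nat j + of_real \<nu> * of_nat n) * e j n" for j n
  proof -
    define z where "z = p n + \<tau> - of_nat j - 1"
    have "\<beta> - of_real \<eta> * of_nat j + of_real \<nu> * of_nat n = of_real \<eta> * z"
      using \<eta>0 by (simp add: \<beta>_def z_def p_def field_simps)
    moreover have "rGamma (p n + \<tau> - of_nat (Suc j)) = z * rGamma (p n + \<tau> - of_nat j)"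
      using rGamma_plus1[of z] by (simp add: z_def algebra_simps)
    ultimately show ?thesis by (simp add: e_def)
  qed
  note W = weighted_deriv_powser_iterate[OF \<nu> I eS x, of N]
  have eN: "e N n = (of_real \<eta> ^ N / of_real \<eta> * Gamma \<tau>) * (a n * (Gamma (p n) * rGamma (p n - \<sigma>)))" for n
    by (simp add: e_def \<tau>_def)
  define C where "C = of_real \<eta> ^ N / of_real \<eta> * Gamma \<tau>"
  have C0: "C \<noteq> 0" using G0 \<eta>0 by (simp add: C_def)
  have "summable (\<lambda>n. norm C * (norm (a n * (Gamma (p n) * rGamma (p n - \<sigma>))) * (x powr \<nu>) ^ n))"
    using W(2) unfolding eN C_def[symmetric] norm_mult[of C] by (simp only: mult.assoc)
  then show s: "summable (\<lambda>n. norm (a n * (Gamma (p n) * rGamma (p n - \<sigma>))) * (x powr \<nu>) ^ n)"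
    using C0 by (simp add: summable_cmult_iff)
  have s': "summable (\<lambda>n. a n * (Gamma (p n) * rGamma (p n - \<sigma>)) * of_real (x powr \<nu>) ^ n)"
    using s by (intro summable_norm_cancel[of "\<lambda>n. a n * (Gamma (p n) * rGamma (p n - \<sigma>)) * of_real (x powr \<nu>) ^ n"])
      (simp add: norm_mult norm_power)
  have "(weighted_deriv \<eta> ^^ N) (frac_integral \<eta> \<sigma> f) x =
     of_real x powr (\<beta> - of_real \<eta> * of_nat N) *
       (C * (\<Sum>n. a n * (Gamma (p n) * rGamma (p n - \<sigma>)) * of_real (x powr \<nu>) ^ n))"
    using W(1) unfolding eN C_def[symmetric] suminf_mult[OF s', symmetric] by (simp only: mult.assoc)
  moreover have "\<beta> - of_real \<eta> * of_nat N = \<mu> - \<sigma> * of_real \<eta>"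
    by (simp add: \<beta>_def \<tau>_def algebra_simps)
  ultimately have "frac_deriv \<eta> \<sigma> f x = of_real \<eta> powr (\<sigma> - of_nat N + 1) / Gamma \<tau> *
      (of_real x powr (\<mu> - \<sigma> * of_real \<eta>) *
        (C * (\<Sum>n. a n * (Gamma (p n) * rGamma (p n - \<sigma>)) * of_real (x powr \<nu>) ^ n)))"
    unfolding frac_deriv_def N_def[symmetric] \<tau>_def[symmetric] by (simp only:)
  also have "\<dots> = (of_real \<eta> powr (\<sigma> - of_nat N + 1) / Gamma \<tau> * C) * of_real x powr (\<mu> - \<sigma> * of_real \<eta>) *
        (\<Sum>n. a n * (Gamma (p n) * rGamma (p n - \<sigma>)) * of_real (x powr \<nu>) ^ n)"
    by (simp only: mult_ac)
  also have "of_real \<eta> powr (\<sigma> - of_nat N + 1) / Gamma \<tau> * C = of_real \<eta> powr \<sigma>"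
    using \<eta> G0 by (simp add: C_def powr_diff powr_add powr_nat)
  finally show "frac_deriv \<eta> \<sigma> f x = of_real \<eta> powr \<sigma> * of_real x powr (\<mu> - \<sigma> * of_real \<eta>) *
           (\<Sum>n. a n * (Gamma (p n) * rGamma (p n - \<sigma>)) * of_real (x powr \<nu>) ^ n)" .
qed

section \<open>The Beta transform of the fractional derivative\<close>

lemma k_mittag_leffler_term_eq:
  "k_mittag_leffler_term k \<theta> q \<xi> \<zeta> z n = k_mittag_leffler_term k \<theta> q \<xi> \<zeta> 1 n * z ^ n"
  by (simp add: k_mittag_leffler_term_def)

text \<open>
  The powers of \<open>k\<close> from the \<open>k\<close>-Pochhammer symbol and the \<open>k\<close>-Gamma function combine to the factor
  \<open>k powr (q - \<xi> / k)\<close> in the Fox-Wright argument and the constant \<open>k powr (1 - \<zeta> / k)\<close>.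
\<close>
lemma k_mittag_leffler_coeff:
  fixes k q r :: real
  assumes k: "k > 0" and \<xi>: "\<xi> / of_real k = of_real r"
  shows "k_mittag_leffler_term k \<theta> q \<xi> \<zeta> 1 n =
     of_real k powr (1 - \<zeta> / of_real k) / Gamma (\<theta> / of_real k) *
     (Gamma (\<theta> / of_real k + of_real q * of_nat n) / Gamma (\<zeta> / of_real k + of_real r * of_nat n)) *
     ((of_real k powr (of_real q - \<xi> / of_real k)) ^ n / fact n)"
proof -
  have k0: "complex_of_real k \<noteq> 0" using k by simp
  have 1: "(of_nat n * \<xi> + \<zeta>) / of_real k = \<zeta> / of_real k + of_real r * of_nat n"
    unfolding \<xi>[symmetric] by (simp add: add_divide_distrib)
  have 2: "(complex_of_real k powr (of_real q - of_real r)) ^ n = of_real k powr (of_nat n * (of_real q - of_real r))"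
    using k0 by (induction n) (simp_all only: power_Suc, simp_all add: powr_add distrib_right)
  have 3: "complex_of_real k powr of_real (of_nat n * q) =
      of_real k powr (of_nat n * (of_real q - of_real r)) * of_real k powr (1 - \<zeta> / of_real k) *
      of_real k powr (\<zeta> / of_real k + of_real r * of_nat n - 1)"
    by (simp only: powr_add[symmetric]) (simp add: algebra_simps)
  have "complex_of_real k powr (\<zeta> / of_real k + of_real r * of_nat n - 1) \<noteq> 0"
    using k0 by simp
  then show ?thesis
    unfolding k_mittag_leffler_term_def k_pochhammer_def real_pochhammer_def k_gamma_def \<xi> 1 2 3
    by (simp add: field_simps)
qed

theorem theorem3:
  fixes x \<eta> \<nu> k q :: real
    and \<sigma> \<mu> \<xi> \<zeta> \<theta> l m :: complex
  defines "f \<equiv> \<lambda>z t. of_real t powr \<mu> * k_mittag_leffler k \<theta> q \<xi> \<zeta> (of_real ((t * z) powr \<nu>))"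
    and "D \<equiv> \<lambda>z. {t. summable (k_mittag_leffler_term k \<theta> q \<xi> \<zeta> (of_real ((t * z) powr \<nu>)))}"
    and "as \<equiv> [(\<theta> / of_real k, q), (\<mu> / of_real \<eta> + 1, \<nu> / \<eta>), (l, \<nu>)]"
    and "bs \<equiv> [(\<zeta> / of_real k, Re (\<xi> / of_real k)), (\<mu> / of_real \<eta> - \<sigma> + 1, \<nu> / \<eta>), (l + m, \<nu>)]"
    and "w \<equiv> of_real k powr (of_real q - \<xi> / of_real k) * of_real (x powr \<nu>)"
  assumes "x > 0" and "q > 0" and "\<eta> > 0"
    and "Re \<sigma> > 0" and "Re \<xi> > 0" and "Re \<zeta> > 0" and "Re \<theta> > 0"
    and "Re \<mu> > 0" and "Re l > 0" and "Re m > 0"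
    and "\<xi> / of_real k \<in> \<real>" and "Re (\<xi> / of_real k) > 0"
    and "\<nu> / \<eta> > 0" and "\<nu> > 0"
    and "1 + Re (\<xi> / of_real k) - q \<ge> 0"
    and "\<And>z. z \<in> {0<..<1} \<Longrightarrow> frac_deriv_defined \<eta> \<sigma> (D z) (f z) x"
    and "beta_integrand (\<lambda>z. frac_deriv \<eta> \<sigma> (f z) x) l m integrable_on {0<..<1}"
    and "summable (fox_wright_term as bs w)"
  shows "beta_transform (\<lambda>z. frac_deriv \<eta> \<sigma> (f z) x) l m =
           Gamma m * of_real x powr (\<mu> - \<sigma> * of_real \<eta>) *
           (of_real \<eta> powr \<sigma> / Gamma (\<theta> / of_real k)) *
           of_real k powr (1 - \<zeta> / of_real k) * fox_wright as bs w"
proof -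
  note x = \<open>x > 0\<close> and \<eta> = \<open>\<eta> > 0\<close> and \<nu> = \<open>\<nu> > 0\<close>
  define r where "r = Re (\<xi> / of_real k)"
  have \<xi>r: "\<xi> / of_real k = of_real r"
    unfolding r_def using \<open>\<xi> / of_real k \<in> \<real>\<close> by (rule of_real_Re[symmetric])
  have r: "r > 0" using \<open>Re (\<xi> / of_real k) > 0\<close> by (simp add: r_def)
  have k: "k > 0"
  proof -
    have "k \<noteq> 0" using r \<xi>r by auto
    then have "\<xi> = of_real (r * k)" using \<xi>r by (simp add: field_simps)
    then have "r * k > 0" using \<open>Re \<xi> > 0\<close> by simp
    then show ?thesis using r by (simp add: zero_less_mult_iff)
  qed
  define c where "c = k_mittag_leffler_term k \<theta> q \<xi> \<zeta> 1"
  define p where "p n = \<mu> / of_real \<eta> + 1 + of_real (\<nu> / \<eta>) * of_nat n" for n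
  define K where "K = of_real \<eta> powr \<sigma> * of_real x powr (\<mu> - \<sigma> * of_real \<eta>)"
  define b where "b n = K * (c n * (Gamma (p n) * rGamma (p n - \<sigma>)) * of_real (x powr \<nu>) ^ n)" for n
  define g where "g z = (\<Sum>n. b n * of_real (z powr \<nu>) ^ n)" for z
  have powr_mult_real: "complex_of_real ((t * z) powr \<nu>) = of_real (t powr \<nu>) * of_real (z powr \<nu>)"
    if "0 < t" "0 < z" for t z using that by (simp add: powr_mult)
  have main: "frac_deriv \<eta> \<sigma> (f z) x = g z \<and> summable (\<lambda>n. norm (b n) * (z powr \<nu>) ^ n)"
    if z: "z \<in> {0<..<1}" for z
  proof -
    \<comment> \<open>\<open>D z\<close> reaches beyond \<open>x\<close>, so \<open>x powr \<nu> * z powr \<nu>\<close> lies strictly inside the disc of convergence\<close>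
    from assms(21)[OF z] obtain d where d: "d > x" "{0<..<d} \<subseteq> D z"
      unfolding frac_deriv_defined_def by blast
    define a where "a n = c n * of_real (z powr \<nu>) ^ n" for n
    have series: "k_mittag_leffler_term k \<theta> q \<xi> \<zeta> (of_real ((t * z) powr \<nu>)) =
        (\<lambda>n. a n * of_real (t powr \<nu>) ^ n)" if "0 < t" for t
    proof
      fix n
      show "k_mittag_leffler_term k \<theta> q \<xi> \<zeta> (of_real ((t * z) powr \<nu>)) n = a n * of_real (t powr \<nu>) ^ n"
        using that z unfolding k_mittag_leffler_term_eq[of _ _ _ _ _ "of_real ((t * z) powr \<nu>)"]
        by (simp add: powr_mult_real a_def c_def power_mult_distrib)
    qed
    have f: "f z t = of_real t powr \<mu> * (\<Sum>n. a n * of_real (t powr \<nu>) ^ n)" if "0 < t" for t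
      unfolding f_def k_mittag_leffler_def series[OF that] ..
    have sm: "summable (\<lambda>n. norm (a n) * (y powr \<nu>) ^ n)" if y: "0 < y" "y < d" for y
    proof -
      obtain t where t: "y < t" "t < d" using y dense by blast
      have "t \<in> D z" using d t y by auto
      then have "summable (\<lambda>n. a n * of_real (t powr \<nu>) ^ n)"
        using series[of t] t y by (simp add: D_def)
      from powser_insidea[OF this, of "of_real (y powr \<nu>)"] show ?thesis
        using t y \<nu> by (simp add: powr_less_mono2 norm_mult norm_power)
    qed
    note F = frac_deriv_powser[OF \<eta> \<nu> \<open>Re \<sigma> > 0\<close> \<open>Re \<mu> > 0\<close> f sm x d(1), folded p_def K_def]
    have ab: "K * (a n * (Gamma (p n) * rGamma (p n - \<sigma>)) * of_real (x powr \<nu>) ^ n) = b n * of_real (z powr \<nu>) ^ n" for n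
      by (simp add: a_def b_def)
    have "summable (\<lambda>n. a n * (Gamma (p n) * rGamma (p n - \<sigma>)) * of_real (x powr \<nu>) ^ n)"
      using F(2) by (intro summable_norm_cancel[of "\<lambda>n. a n * (Gamma (p n) * rGamma (p n - \<sigma>)) * of_real (x powr \<nu>) ^ n"])
        (simp add: norm_mult norm_power)
    then have "g z = K * (\<Sum>n. a n * (Gamma (p n) * rGamma (p n - \<sigma>)) * of_real (x powr \<nu>) ^ n)"
      unfolding g_def ab[symmetric] by (rule suminf_mult)
    then have "frac_deriv \<eta> \<sigma> (f z) x = g z" using F(1) by (simp only:)
    moreover have "summable (\<lambda>n. norm K * (norm (a n * (Gamma (p n) * rGamma (p n - \<sigma>))) * (x powr \<nu>) ^ n))"
      by (rule summable_mult[OF F(2)])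
    moreover have "norm K * (norm (a n * (Gamma (p n) * rGamma (p n - \<sigma>))) * (x powr \<nu>) ^ n) = norm (b n) * (z powr \<nu>) ^ n" for n
      using arg_cong[OF ab[of n], of norm] by (simp add: norm_mult norm_power mult_ac)
    ultimately show ?thesis by simp
  qed
  define C where "C = Gamma m * of_real x powr (\<mu> - \<sigma> * of_real \<eta>) *
           (of_real \<eta> powr \<sigma> / Gamma (\<theta> / of_real k)) * of_real k powr (1 - \<zeta> / of_real k)"
  have bC: "b n * Beta (l + of_real \<nu> * of_nat n) m = C * fox_wright_term as bs w n" for n
  proof -
    have p': "\<mu> / of_real \<eta> - \<sigma> + 1 + of_real (\<nu> / \<eta>) * of_nat n = p n - \<sigma>"
      by (simp add: p_def)
    have lm: "l + m + of_real \<nu> * of_nat n = l + of_real \<nu> * of_nat n + m" by simp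
    have "fox_wright_term as bs w n =
       Gamma (\<theta> / of_real k + of_real q * of_nat n) * (Gamma (p n) * Gamma (l + of_real \<nu> * of_nat n)) /
       (Gamma (\<zeta> / of_real k + of_real r * of_nat n) * (Gamma (p n - \<sigma>) * Gamma (l + of_real \<nu> * of_nat n + m))) *
       (w ^ n / fact n)"
      unfolding fox_wright_term_def as_def bs_def r_def[symmetric]
      by (simp only: list.map prod.case prod_list.Cons prod_list.Nil mult_1_right p' lm p_def[symmetric])
    then show ?thesis
      unfolding b_def c_def k_mittag_leffler_coeff[OF k \<xi>r] C_def K_def w_def Beta_def
      by (simp add: rGamma_inverse_Gamma divide_inverse power_mult_distrib mult_ac)
  qed
  have cong: "beta_integrand (\<lambda>z. frac_deriv \<eta> \<sigma> (f z) x) l m z = beta_integrand g l m z" if "z \<in> {0<..<1}" for z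
    using main[OF that] by (simp add: beta_integrand_def)
  have "beta_transform (\<lambda>z. frac_deriv \<eta> \<sigma> (f z) x) l m = integral {0<..<1} (beta_integrand g l m)"
    unfolding beta_transform_def by (rule integral_cong) (rule cong)
  also have "\<dots> = (\<Sum>n. b n * Beta (l + of_real \<nu> * of_nat n) m)"
    unfolding g_def
  proof (rule integral_beta_powser[OF \<open>Re l > 0\<close> \<open>Re m > 0\<close> \<nu>])
    show "summable (\<lambda>n. norm (b n) * (z powr \<nu>) ^ n)" if "0 < z" "z < 1" for z
      using main[of z] that by simp
    show "summable (\<lambda>n. b n * Beta (l + of_real \<nu> * of_nat n) m)"
      unfolding bC by (rule summable_mult) fact
    show "beta_integrand (\<lambda>z. \<Sum>n. b n * of_real (z powr \<nu>) ^ n) l m integrable_on {0<..<1}"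
      using assms(22) cong unfolding g_def by (rule integrable_eq)
  qed
  also have "\<dots> = C * fox_wright as bs w"
    unfolding bC fox_wright_def by (rule suminf_mult) fact
  finally show ?thesis by (simp only: C_def)
qed

end
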